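(* Let $\mathfrak{R}$ be the groupoid of germs of the golden mean rotation $R\colon\mathcal{F}\to\mathcal{F}$. Then $H_0(\mathfrak{R})\cong\mathbb{Z}^2$ and $H_1(\mathfrak{R})\cong\mathbb{Z}$.
   Context: Let $\varphi=\frac{1+\sqrt5}{2}$. The space $\mathcal{F}$ is obtained from the interval $[0,1]$ by replacing every point $x\in\mathbb{Z}[\varphi]\cap(0,1)$ by two points $x-0<x+0$, with the natural order and the order topology; it is a Cantor set. For $x,y\in\mathbb{Z}[\varphi]\cap[0,1]$ write $[x,y]$ for the clopen interval $[x+0,y-0]\subset\mathcal{F}$ (with $0+0=0$, $1-0=1$). The rotation $x\mapsto x+\varphi$ of $\mathbb{R}/\mathbb{Z}$ lifts to the homeomorphism $R$ of $\mathcal{F}$ acting by $x\mapsto x+\varphi^{-1}$ from $[0,\varphi^{-2}]$ onto $[\varphi^{-1},1]$ and by $x\mapsto x+\varphi^{-1}-1$ from $[\varphi^{-2},1]$ onto $[0,\varphi^{-1}]$. $\mathfrak{R}$ is the (ample) groupoid of germs of the $\mathbb{Z}$-action on $\mathcal{F}$ generated by $R$. Homology. For an ample groupoid $\mathfrak{G}$ with $\mathsf{s}(g)=g^{-1}g$, $\mathsf{r}(g)=gg^{-1}$: $\mathfrak{G}^{(0)}$ is the unit space and $\mathfrak{G}^{(n)}$ the space of composable sequences $(g_1,\ldots,g_n)$, $\mathsf{s}(g_i)=\mathsf{r}(g_{i+1})$. $C_c(\mathfrak{G}^{(n)};\mathbb{Z})$ is the group of functions $\mathfrak{G}^{(n)}\to\mathbb{Z}$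 generated by indicators of sets $\{(g_1,\ldots,g_n)\in\mathfrak{G}^{(n)}:g_i\in F_i\}$ for compact open bisections $F_i$ with $\mathsf{s}(F_i)=\mathsf{r}(F_{i+1})$ (indicators of compact open sets for $n=0$). Let $d_0(g_1,\ldots,g_n)=(g_2,\ldots,g_n)$, $d_n(g_1,\ldots,g_n)=(g_1,\ldots,g_{n-1})$, $d_i(g_1,\ldots,g_n)=(\ldots,g_ig_{i+1},\ldots)$ for $0<i<n$; for $n=1$, $d_0,d_1$ are $\mathsf{r},\mathsf{s}$. Let $\delta_n=\sum_{i=0}^n(-1)^i(d_i)_*$, where $(d_i)_*f(z)=\sum_{d_i(y)=z}f(y)$, $\delta_0=0$, and $H_n(\mathfrak{G})=\ker\delta_n/\operatorname{im}\delta_{n+1}$. *)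

theory Defs
  imports "HOL-Analysis.Analysis" "HOL-Algebra.Elementary_Groups" "HOL-Algebra.Product_Groups"
begin

section \<open>Topological groupoids and their homology\<close>

text \<open>
  A groupoid is given by the topology of its space of arrows (whose underlying set is the set of
  arrows), a multiplication, which is meaningful only on composable pairs, and an inversion.
  Units are arrows.
\<close>

record 'g top_groupoid =
  arrow_topology :: "'g topology"
  gmult :: "'g \<Rightarrow> 'g \<Rightarrow> 'g"
  ginv :: "'g \<Rightarrow> 'g"

definition arrows :: "'g top_groupoid \<Rightarrow> 'g set" where
  "arrows G = topspace (arrow_topology G)"

definition gsource :: "'g top_groupoid \<Rightarrow> 'g \<Rightarrow> 'g" where
  "gsource G g = gmult G (ginv G g) g"

definition grange :: "'g top_groupoid \<Rightarrow> 'g \<Rightarrow> 'g" where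
  "grange G g = gmult G g (ginv G g)"

definition gunits :: "'g top_groupoid \<Rightarrow> 'g set" where
  "gunits G = gsource G ` arrows G"

definition unit_topology :: "'g top_groupoid \<Rightarrow> 'g topology" where
  "unit_topology G = subtopology (arrow_topology G) (gunits G)"

text \<open>
  The space of composable sequences of length \<open>n\<close>, as lists.  A unit \<open>u\<close> is represented in
  degree 0 by the one-element list \<open>[u]\<close>, so that all degrees live in one type.
\<close>

definition nerve :: "'g top_groupoid \<Rightarrow> nat \<Rightarrow> 'g list set" where
  "nerve G n =
     (if n = 0 then (\<lambda>u. [u]) ` gunits G
      else {gs. length gs = n \<and> set gs \<subseteq> arrows G \<and>
                (\<forall>i. Suc i < n \<longrightarrow> gsource G (gs ! i) = grange G (gs ! Suc i))})"

definition compact_open_bisection :: "'g top_groupoid \<Rightarrow> 'g set \<Rightarrow> bool" where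
  "compact_open_bisection G F \<longleftrightarrow>
     openin (arrow_topology G) F \<and> compactin (arrow_topology G) F \<and>
     homeomorphic_map (subtopology (arrow_topology G) F)
       (subtopology (unit_topology G) (gsource G ` F)) (gsource G) \<and>
     homeomorphic_map (subtopology (arrow_topology G) F)
       (subtopology (unit_topology G) (grange G ` F)) (grange G)"

definition basic_sets :: "'g top_groupoid \<Rightarrow> nat \<Rightarrow> 'g list set set" where
  "basic_sets G n =
     (if n = 0 then
        {(\<lambda>u. [u]) ` U | U. openin (unit_topology G) U \<and> compactin (unit_topology G) U}
      else
        {{gs \<in> nerve G n. \<forall>i<n. gs ! i \<in> Fs ! i} | Fs.
           length Fs = n \<and> (\<forall>F\<in>set Fs. compact_open_bisection G F) \<and>
           (\<forall>i. Suc i < n \<longrightarrow> gsource G ` (Fs ! i) = grange G ` (Fs ! Suc i))})"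

text \<open>
  Integer-valued functions on the nerve are extended by 0 to all lists; the ambient group is the
  group of all functions to the integers with pointwise addition.
\<close>

definition chains :: "'g top_groupoid \<Rightarrow> nat \<Rightarrow> ('g list \<Rightarrow> int) monoid" where
  "chains G n =
     subgroup_generated (product_group UNIV (\<lambda>_. integer_group)) (indicator ` basic_sets G n)"

text \<open>
  The list \<open>gs\<close> of length \<open>n \<ge> 1\<close> stands for the sequence of arrows numbered from 1, so
  the product of the arrows number \<open>i\<close> and \<open>i + 1\<close> is the one of the list
  entries \<open>i - 1\<close> and \<open>i\<close>.
\<close>

definition face :: "'g top_groupoid \<Rightarrow> nat \<Rightarrow> nat \<Rightarrow> 'g list \<Rightarrow> 'g list" where
  "face G n i gs =
     (if n = 1 then [if i = 0 then grange G (gs ! 0) else gsource G (gs ! 0)]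
      else if i = 0 then tl gs
      else if i = n then butlast gs
      else take (i - 1) gs @ gmult G (gs ! (i - 1)) (gs ! i) # drop (i + 1) gs)"

text \<open>
  The restriction to \<open>f y \<noteq> 0\<close> matters: fibres of \<open>d\<close> may be infinite, but they meet the
  support of a chain in finitely many points, whereas \<open>sum\<close> over an infinite set is 0.
\<close>

definition pushforward :: "'a set \<Rightarrow> ('a \<Rightarrow> 'b) \<Rightarrow> ('a \<Rightarrow> int) \<Rightarrow> 'b \<Rightarrow> int" where
  "pushforward Y d f z = (\<Sum>y | y \<in> Y \<and> d y = z \<and> f y \<noteq> 0. f y)"

definition boundary :: "'g top_groupoid \<Rightarrow> nat \<Rightarrow> ('g list \<Rightarrow> int) \<Rightarrow> 'g list \<Rightarrow> int" where
  "boundary G n f =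
     (if n = 0 then (\<lambda>_. 0)
      else (\<lambda>z. \<Sum>i\<le>n. (-1) ^ i * pushforward (nerve G n) (face G n i) f z))"

text \<open>In degree 0 the codomain given to \<open>kernel\<close> is irrelevant, the map being zero.\<close>

definition cycles :: "'g top_groupoid \<Rightarrow> nat \<Rightarrow> ('g list \<Rightarrow> int) monoid" where
  "cycles G n =
     (chains G n)\<lparr>carrier := kernel (chains G n) (chains G (n - 1)) (boundary G n)\<rparr>"

definition groupoid_homology :: "'g top_groupoid \<Rightarrow> nat \<Rightarrow> ('g list \<Rightarrow> int) set monoid" where
  "groupoid_homology G n = cycles G n Mod (boundary G (Suc n) ` carrier (chains G (Suc n)))"


section \<open>Groupoids of germs\<close>

text \<open>
  For an action \<open>act\<close> by homeomorphisms, the germ of the transformation \<open>g\<close> at \<open>x\<close> is the class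
  of all pairs \<open>(h, x)\<close> such that \<open>g\<close> and \<open>h\<close> act in the same way on a neighbourhood of \<open>x\<close>.
\<close>

definition germ :: "('a \<Rightarrow> 'x \<Rightarrow> 'x) \<Rightarrow> 'a \<Rightarrow> 'x::topological_space \<Rightarrow> ('a \<times> 'x) set" where
  "germ act g x = {(h, y). y = x \<and> (\<forall>\<^sub>F z in nhds x. act h z = act g z)}"

text \<open>
  The unions below are over representatives; each has a single value when the product is
  defined, respectively when the argument is a germ.  The product of the germ of \<open>g\<close> at
  \<open>act h x\<close> and the germ of \<open>h\<close> at \<open>x\<close> is the germ of \<open>g + h\<close> at \<open>x\<close>.
\<close>

definition germ_groupoid ::
  "('a::group_add \<Rightarrow> 'x \<Rightarrow> 'x::topological_space) \<Rightarrow> ('a \<times> 'x) set top_groupoid" where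
  "germ_groupoid act =
     \<lparr>arrow_topology = topology_generated_by {germ act g ` U | g U. open U},
      gmult = (\<lambda>\<gamma> \<eta>. \<Union>{germ act (g + h) x | g h x. (g, act h x) \<in> \<gamma> \<and> (h, x) \<in> \<eta>}),
      ginv = (\<lambda>\<gamma>. \<Union>{germ act (- g) (act g x) | g x. (g, x) \<in> \<gamma>})\<rparr>"

definition int_iterate :: "('x \<Rightarrow> 'x) \<Rightarrow> int \<Rightarrow> 'x \<Rightarrow> 'x" where
  "int_iterate f n = (if n \<ge> 0 then f ^^ nat n else inv_into UNIV f ^^ nat (- n))"


section \<open>The golden mean rotation\<close>

definition golden :: real where
  "golden = (1 + sqrt 5) / 2"

text \<open>Since \<open>golden\<^sup>2 = golden + 1\<close>, this is the ring generated by \<open>golden\<close>.\<close>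

definition golden_ints :: "real set" where
  "golden_ints = {of_int a + of_int b * golden | a b. True}"

text \<open>
  The points \<open>x - 0\<close> and \<open>x + 0\<close> are encoded as \<open>(x, -1)\<close> and \<open>(x, 1)\<close>, the points that are not
  split as \<open>(x, 0)\<close>.  The end points 0 and 1 are encoded as \<open>0 + 0\<close> and \<open>1 - 0\<close>.
\<close>

typedef split_interval =
  "{(x, t) :: real \<times> int | x t. 0 \<le> x \<and> x \<le> 1 \<and>
      (if x = 0 then t = 1 else if x = 1 then t = -1
       else if x \<in> golden_ints then t = -1 \<or> t = 1 else t = 0)}"
  by (rule exI[of _ "(0, 1)"]) auto

instantiation split_interval :: linorder
begin

definition less_split_interval :: "split_interval \<Rightarrow> split_interval \<Rightarrow> bool" where
  "p < q \<longleftrightarrow> fst (Rep_split_interval p) < fst (Rep_split_interval q) \<or>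
     fst (Rep_split_interval p) = fst (Rep_split_interval q) \<and>
     snd (Rep_split_interval p) < snd (Rep_split_interval q)"

definition less_eq_split_interval :: "split_interval \<Rightarrow> split_interval \<Rightarrow> bool" where
  "p \<le> q \<longleftrightarrow> p < q \<or> p = (q :: split_interval)"

instance
  by standard
    (auto simp: less_split_interval_def less_eq_split_interval_def
      simp flip: Rep_split_interval_inject intro: prod_eqI)

end

instantiation split_interval :: linorder_topology
begin

definition open_split_interval :: "split_interval set \<Rightarrow> bool" where
  "open_split_interval = generate_topology (range lessThan \<union> range greaterThan)"

instance
  by standard (rule open_split_interval_def)

end

definition left_limit :: "real \<Rightarrow> split_interval" where
  "left_limit x = Abs_split_interval (x, -1)"

definition right_limit :: "real \<Rightarrow> split_interval" where
  "right_limit x = Abs_split_interval (x, 1)"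

definition clopen_interval :: "real \<Rightarrow> real \<Rightarrow> split_interval set" where
  "clopen_interval x y = {right_limit x .. left_limit y}"

definition golden_rotation :: "split_interval \<Rightarrow> split_interval" where
  "golden_rotation p =
     (case Rep_split_interval p of (x, t) \<Rightarrow>
        Abs_split_interval
          (if p \<in> clopen_interval 0 (inverse golden ^ 2) then x + inverse golden
           else x + inverse golden - 1, t))"


lemma golden_facts: "golden > 1" "inverse golden = golden - 1" "inverse golden ^ 2 = 2 - golden" "golden < 2"
proof -
  have s: "sqrt 5 > 1" "sqrt 5 < 3"
    by (simp_all add: real_less_lsqrt)
  show g1: "golden > 1" "golden < 2"
    using s by (simp_all add: golden_def)
  have sq: "golden * golden = golden + 1"
    by (simp add: golden_def field_simps)
  have "golden * (golden - 1) = 1"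
    using sq by (simp add: algebra_simps)
  then show i: "inverse golden = golden - 1"
    by (rule inverse_unique)
  show "inverse golden ^ 2 = 2 - golden"
    unfolding i using sq by (simp add: power2_eq_square algebra_simps)
qed

lemma golden_ints_shift:
  "x + (of_int a + of_int b * golden) \<in> golden_ints \<longleftrightarrow> x \<in> golden_ints"
proof -
  have *: "x + (of_int a + of_int b * golden) \<in> golden_ints" if x: "x \<in> golden_ints" for x a b
  proof -
    obtain c d where "x = of_int c + of_int d * golden"
      using x unfolding golden_ints_def by blast
    then have "x + (of_int a + of_int b * golden) = of_int (c + a) + of_int (d + b) * golden"
      by (simp add: algebra_simps)
    then show ?thesis
      unfolding golden_ints_def by blast
  qed
  show ?thesis
    using *[of x a b] *[of "x + (of_int a + of_int b * golden)" "- a" "- b"] by auto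
qed

lemma golden_ints_shifts:
  "x + golden \<in> golden_ints \<longleftrightarrow> x \<in> golden_ints"
  "x + (golden - 1) \<in> golden_ints \<longleftrightarrow> x \<in> golden_ints"
  "x + (golden - 1) - 1 \<in> golden_ints \<longleftrightarrow> x \<in> golden_ints"
  "2 - golden \<in> golden_ints" "golden - 1 \<in> golden_ints" "0 \<in> golden_ints" "1 \<in> golden_ints"
proof -
  show "x + golden \<in> golden_ints \<longleftrightarrow> x \<in> golden_ints"
    using golden_ints_shift[of x 0 1] by simp
  show "x + (golden - 1) \<in> golden_ints \<longleftrightarrow> x \<in> golden_ints"
    using golden_ints_shift[of x "-1" 1] by simp
  show "x + (golden - 1) - 1 \<in> golden_ints \<longleftrightarrow> x \<in> golden_ints"
    using golden_ints_shift[of x "-2" 1] by (simp add: algebra_simps)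
  show 0: "0 \<in> golden_ints"
    unfolding golden_ints_def by (simp, rule exI[of _ 0], rule exI[of _ 0]) simp
  show "2 - golden \<in> golden_ints" "golden - 1 \<in> golden_ints" "1 \<in> golden_ints"
    using golden_ints_shift[of 0 2 "-1"] golden_ints_shift[of 0 "-1" 1] golden_ints_shift[of 0 1 0] 0
    by (simp_all add: algebra_simps)
qed

lemma Rep_left_limit:
  "x \<in> golden_ints \<Longrightarrow> 0 < x \<Longrightarrow> x \<le> 1 \<Longrightarrow> Rep_split_interval (left_limit x) = (x, -1)"
  unfolding left_limit_def by (rule Abs_split_interval_inverse) auto

lemma Rep_right_limit:
  "x \<in> golden_ints \<Longrightarrow> 0 \<le> x \<Longrightarrow> x < 1 \<Longrightarrow> Rep_split_interval (right_limit x) = (x, 1)"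
  unfolding right_limit_def by (rule Abs_split_interval_inverse) auto

lemma less_eq_split_interval_iff:
  "p \<le> q \<longleftrightarrow> fst (Rep_split_interval p) < fst (Rep_split_interval q) \<or>
     fst (Rep_split_interval p) = fst (Rep_split_interval q) \<and>
     snd (Rep_split_interval p) \<le> snd (Rep_split_interval q)"
  by (auto simp: less_eq_split_interval_def less_split_interval_def
      simp flip: Rep_split_interval_inject intro: prod_eqI)

lemma clopen_interval_iff:
  assumes "Rep_split_interval p = (z, t)" "x \<in> golden_ints" "y \<in> golden_ints" "0 \<le> x" "x < y" "y \<le> 1"
  shows "p \<in> clopen_interval x y \<longleftrightarrow> (x < z \<or> x = z \<and> t = 1) \<and> (z < y \<or> z = y \<and> t = -1)"
  using Rep_split_interval[of p] assms
  by (auto simp: clopen_interval_def less_eq_split_interval_iff Rep_left_limit Rep_right_limit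
      split: if_splits)

lemma Rep_golden_rotation:
  assumes "Rep_split_interval p = (x, t)"
  shows "Rep_split_interval (golden_rotation p) =
    (if x < 2 - golden \<or> x = 2 - golden \<and> t = -1 then x + golden - 1 else x + golden - 2, t)"
proof -
  note g = golden_facts(1,4)
  have p: "p \<in> clopen_interval 0 (inverse golden ^ 2) \<longleftrightarrow> x < 2 - golden \<or> x = 2 - golden \<and> t = -1"
    using Rep_split_interval[of p] assms g
    by (subst clopen_interval_iff[OF assms])
      (auto simp: golden_facts(3) golden_ints_shifts split: if_splits)
  have "x + golden - 1 \<in> golden_ints \<longleftrightarrow> x \<in> golden_ints"
    "x + golden - 2 \<in> golden_ints \<longleftrightarrow> x \<in> golden_ints"
    using golden_ints_shifts(2,3)[of x] by (simp_all add: algebra_simps)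
  moreover have "x \<in> golden_ints" if "x + golden = 2"
    using golden_ints_shifts(4) that by (simp add: eq_diff_eq[symmetric])
  ultimately have "(if x < 2 - golden \<or> x = 2 - golden \<and> t = -1 then x + golden - 1 else x + golden - 2, t)
      \<in> range Rep_split_interval"
    unfolding type_definition.Rep_range[OF type_definition_split_interval]
    using Rep_split_interval[of p] assms g golden_ints_shifts(4,6,7)
    by (auto split: if_splits)
  then have "Rep_split_interval (Abs_split_interval
      (if x < 2 - golden \<or> x = 2 - golden \<and> t = -1 then x + golden - 1 else x + golden - 2, t)) =
      (if x < 2 - golden \<or> x = 2 - golden \<and> t = -1 then x + golden - 1 else x + golden - 2, t)"
    by (auto simp: Rep_split_interval_inverse)
  then show ?thesis
    unfolding golden_rotation_def assms prod.case p
    unfolding golden_facts(2)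
    by (simp add: algebra_simps cong: if_cong)
qed

lemma golden_rotation_image:
  "golden_rotation ` clopen_interval 0 (inverse golden ^ 2) = clopen_interval (inverse golden) 1"
  "golden_rotation ` clopen_interval (inverse golden ^ 2) 1 = clopen_interval 0 (inverse golden)"
proof -
  note g = golden_facts(1,4)
  have shift: "\<exists>p. Rep_split_interval p = (y, t)"
    if "0 \<le> y \<and> y \<le> 1 \<and>
      (if y = 0 then t = 1 else if y = 1 then t = -1
       else if y \<in> golden_ints then t = -1 \<or> t = 1 else t = 0)" for y t
    using that by (intro exI[of _ "Abs_split_interval (y, t)"] Abs_split_interval_inverse) auto
  have sh: "x + 1 - golden \<in> golden_ints \<longleftrightarrow> x \<in> golden_ints"
    "x + 2 - golden \<in> golden_ints \<longleftrightarrow> x \<in> golden_ints" for x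
    using golden_ints_shift[of x 1 "-1"] golden_ints_shift[of x 2 "-1"]
    by (simp_all add: algebra_simps)
  show "golden_rotation ` clopen_interval 0 (inverse golden ^ 2) = clopen_interval (inverse golden) 1"
  proof (intro equalityI subsetI)
    fix q assume "q \<in> golden_rotation ` clopen_interval 0 (inverse golden ^ 2)"
    then obtain p where p: "p \<in> clopen_interval 0 (inverse golden ^ 2)" "q = golden_rotation p"
      by auto
    obtain x t where x: "Rep_split_interval p = (x, t)" by force
    have c: "(0 < x \<or> 0 = x \<and> t = 1) \<and> (x < 2 - golden \<or> x = 2 - golden \<and> t = -1)"
      using p(1) g by (subst (asm) clopen_interval_iff[OF x]) (auto simp: golden_facts(3) golden_ints_shifts)
    have "Rep_split_interval q = (x + golden - 1, t)"
      using Rep_golden_rotation[OF x] p(2) c by simp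
    from clopen_interval_iff[OF this, of "inverse golden" 1]
    show "q \<in> clopen_interval (inverse golden) 1"
      using c g by (auto simp: golden_facts(2) golden_ints_shifts)
  next
    fix q assume q: "q \<in> clopen_interval (inverse golden) 1"
    obtain y t where y: "Rep_split_interval q = (y, t)" by force
    have c: "(golden - 1 < y \<or> golden - 1 = y \<and> t = 1) \<and> (y < 1 \<or> y = 1 \<and> t = -1)"
      using q g by (subst (asm) clopen_interval_iff[OF y]) (auto simp: golden_facts(2) golden_ints_shifts)
    obtain p where p: "Rep_split_interval p = (y + 1 - golden, t)"
      using shift[of "y + 1 - golden" t] Rep_split_interval[of q] y c g sh(1)[of y]
        golden_ints_shifts(4,5,7)
      by (auto split: if_splits)
    have "Rep_split_interval (golden_rotation p) = (y, t)"
      using c g by (subst Rep_golden_rotation[OF p]) auto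
    then have "q = golden_rotation p"
      using y by (metis Rep_split_interval_inject)
    moreover have "p \<in> clopen_interval 0 (inverse golden ^ 2)"
      using c g by (subst clopen_interval_iff[OF p]) (auto simp: golden_facts(3) golden_ints_shifts)
    ultimately show "q \<in> golden_rotation ` clopen_interval 0 (inverse golden ^ 2)" by auto
  qed
  show "golden_rotation ` clopen_interval (inverse golden ^ 2) 1 = clopen_interval 0 (inverse golden)"
  proof (intro equalityI subsetI)
    fix q assume "q \<in> golden_rotation ` clopen_interval (inverse golden ^ 2) 1"
    then obtain p where p: "p \<in> clopen_interval (inverse golden ^ 2) 1" "q = golden_rotation p"
      by auto
    obtain x t where x: "Rep_split_interval p = (x, t)" by force
    have c: "(2 - golden < x \<or> 2 - golden = x \<and> t = 1) \<and> (x < 1 \<or> x = 1 \<and> t = -1)"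
      using p(1) g by (subst (asm) clopen_interval_iff[OF x]) (auto simp: golden_facts(3) golden_ints_shifts)
    have "Rep_split_interval q = (x + golden - 2, t)"
      using Rep_golden_rotation[OF x] p(2) c by auto
    from clopen_interval_iff[OF this, of 0 "inverse golden"]
    show "q \<in> clopen_interval 0 (inverse golden)"
      using c g by (auto simp: golden_facts(2) golden_ints_shifts)
  next
    fix q assume q: "q \<in> clopen_interval 0 (inverse golden)"
    obtain y t where y: "Rep_split_interval q = (y, t)" by force
    have c: "(0 < y \<or> 0 = y \<and> t = 1) \<and> (y < golden - 1 \<or> y = golden - 1 \<and> t = -1)"
      using q g by (subst (asm) clopen_interval_iff[OF y]) (auto simp: golden_facts(2) golden_ints_shifts)
    obtain p where p: "Rep_split_interval p = (y + 2 - golden, t)"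
      using shift[of "y + 2 - golden" t] Rep_split_interval[of q] y c g sh(2)[of y]
        golden_ints_shifts(4,5,6)
      by (auto split: if_splits)
    have "Rep_split_interval (golden_rotation p) = (y, t)"
      using c g by (subst Rep_golden_rotation[OF p]) auto
    then have "q = golden_rotation p"
      using y by (metis Rep_split_interval_inject)
    moreover have "p \<in> clopen_interval (inverse golden ^ 2) 1"
      using c g by (subst clopen_interval_iff[OF p]) (auto simp: golden_facts(3) golden_ints_shifts)
    ultimately show "q \<in> golden_rotation ` clopen_interval (inverse golden ^ 2) 1" by auto
  qed
qed

definition golden_groupoid :: "(int \<times> split_interval) set top_groupoid" where
  "golden_groupoid = germ_groupoid (int_iterate golden_rotation)"

end

theory Submission
  imports Defs "HOL-Computational_Algebra.Group_Closure" "HOL-Library.Function_Algebras"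
    "HOL-Library.Groups_Big_Fun"
begin

text \<open>
  The action of the integers generated by a homeomorphism \<open>T\<close> of a compact Hausdorff space without
  periodic points is free, so its groupoid of germs is the transformation groupoid, with arrows
  \<open>(n, x)\<close>.  Replacing the arrow \<open>(n, x)\<close> by the path \<open>x, T x, \<dots>, T\<^sup>n x\<close> of arrows \<open>(1, _)\<close>
  identifies \<open>H\<^sub>0\<close> with the locally constant integer functions modulo the coboundaries
  \<open>g \<circ> T - g\<close>, and \<open>H\<^sub>1\<close> with the \<open>T\<close>-invariant locally constant functions.

  For the golden mean rotation the orbits are dense, so the invariant functions are the constants.
  Let \<open>J\<close> be the interval on which the rotation wraps around.  The initial segments \<open>[0, y]\<close> generate
  the locally constant functions.  If \<open>y = y' + golden - 1 - c\<close> with \<open>c\<close> equal to 0 or 1, the indicator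
  function of \<open>[0, y]\<close> composed with the rotation is that of \<open>[0, y']\<close> plus \<open>1\<^sub>J - c\<close>; by induction
  every class modulo coboundaries contains some \<open>a + b 1\<^sub>J\<close>.  This form is unique: the position
  coordinate shows that \<open>1\<^sub>J\<close> is cohomologous over the reals to the irrational constant
  \<open>golden - 1\<close>, and nonzero constants are not coboundaries of bounded functions.
\<close>

section \<open>Chains and homology of topological groupoids\<close>

text \<open>Pushforward sums over the support, so it is additive only where fibres meet supports in
  finite sets. This shapes the treatment of chains: freeness labels every germ by an integer and a
  point, compactness cuts bisections into finitely many pieces with fixed integer labels, and on
  such pieces every face map is injective. All later arguments run over these generators and their
  differences. Degrees up to 2 suffice. The boundary of a composable pair says that an arrow of
  exponent \<open>m + n\<close> is homologous to the sum of its two factors. Counting unit steps is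
  a cocycle and so respects this relation, while its case \<open>m = 1\<close> reduces every chain
  to unit steps. Irrationality of \<open>golden\<close> enters three times: for freeness, for
  density of orbits, and for the independence of 1 and \<open>golden - 1\<close> behind the rank 2
  in degree 0. Splitting the points makes segments clopen, hence the rotation continuous in spite of
  its jump.\<close>

lemma group_closure_subsetI:
  fixes S M :: "'a::ab_group_add set"
  assumes "S \<subseteq> M" "0 \<in> M" "\<And>f g. f \<in> M \<Longrightarrow> g \<in> M \<Longrightarrow> f - g \<in> M"
  shows "group_closure S \<subseteq> M"
proof
  fix f assume "f \<in> group_closure S"
  then show "f \<in> M"
    by induction (use assms in auto)
qed

lemma group_closure_incl: "s \<in> S \<Longrightarrow> s \<in> group_closure S"
  by (simp add: group_closure.base)

lemma group_closure_mono:
  assumes "S \<subseteq> group_closure T"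
  shows "group_closure S \<subseteq> group_closure T"
  by (rule group_closure_subsetI) (use assms in \<open>auto intro: group_closure.diff\<close>)

text \<open>Additivity of \<open>h\<close> is asked for only on the generated subgroup, because
  boundary maps are additive on chains but not on arbitrary functions.\<close>

lemma image_group_closure:
  fixes h :: "'a::ab_group_add \<Rightarrow> 'b::ab_group_add"
  assumes h: "\<And>f g. f \<in> group_closure S \<Longrightarrow> g \<in> group_closure S \<Longrightarrow> h (f - g) = h f - h g"
  shows "h ` group_closure S = group_closure (h ` S)"
proof
  have h0: "h 0 = 0"
    using h[of 0 0] by simp
  have "group_closure S \<subseteq> {f \<in> group_closure S. h f \<in> group_closure (h ` S)}"
    by (rule group_closure_subsetI) (auto simp: h h0 intro: group_closure.diff group_closure_incl)
  then show "h ` group_closure S \<subseteq> group_closure (h ` S)"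
    by auto
  show "group_closure (h ` S) \<subseteq> h ` group_closure S"
    by (rule group_closure_subsetI)
      (auto simp: image_iff intro: group_closure_incl bexI[of _ 0] simp: h0 h[symmetric] intro: group_closure.diff)
qed

lemma group_closure_sum:
  assumes "\<And>i. i \<in> I \<Longrightarrow> f i \<in> group_closure S"
  shows "(\<Sum>i\<in>I. f i) \<in> group_closure S"
  using assms by (induction I rule: infinite_finite_induct) (auto intro: group_closure_add)

section \<open>Chain groups, pushforward and boundary\<close>

text \<open>Passes from groups with explicit carriers to pointwise subtraction of functions, where
  \<open>group_closure\<close> offers an induction with two cases: zero or a generator, and a
  difference.\<close>

lemma carrier_chains: "carrier (chains G n) = group_closure (indicator ` basic_sets G n)"
proof -
  define P where "P = (product_group UNIV (\<lambda>_. integer_group) :: ('a list \<Rightarrow> int) monoid)"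
  let ?S = "indicator ` basic_sets G n :: ('a list \<Rightarrow> int) set"
  have P: "group P"
    by (simp add: P_def)
  have mult0: "f \<otimes>\<^bsub>P\<^esub> g = f + g" and one0: "\<one>\<^bsub>P\<^esub> = 0" for f g
    by (auto simp: P_def product_group_def)
  have carrier: "carrier P = UNIV"
    by (auto simp: P_def PiE_def)
  have inv0: "inv\<^bsub>P\<^esub> f = - f" for f
    by (rule group.inv_equality[OF P]) (auto simp: mult0 one0 carrier)
  have "generate P ?S = group_closure ?S"
  proof (intro equalityI subsetI)
    fix f assume "f \<in> generate P ?S"
    then show "f \<in> group_closure ?S"
    proof induction
      case one
      show ?case
        unfolding one0 by (rule zero_in_group_closure)
    next
      case (incl f)
      then show ?case
        by (rule group_closure_incl)
    next
      case (inv f)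
      then show ?case
        unfolding inv0 group_closure_minus_iff by (rule group_closure_incl)
    next
      case (eng f g)
      then show ?case
        unfolding mult0 by (intro group_closure_add)
    qed
  next
    fix f assume "f \<in> group_closure ?S"
    then show "f \<in> generate P ?S"
    proof induction
      case (base s)
      then show ?case
        using generate.one[of P ?S] generate.incl[of _ ?S P] unfolding one0 by auto
    next
      case (diff s t)
      then have "s \<otimes>\<^bsub>P\<^esub> inv\<^bsub>P\<^esub> t \<in> generate P ?S"
        by (intro generate.eng group.generate_m_inv_closed[OF P]) (auto simp: carrier)
      then show ?case
        unfolding mult0 inv0 by (metis diff_conv_add_uminus)
    qed
  qed
  then show ?thesis
    using carrier by (simp add: chains_def subgroup_generated_def P_def)
qed

lemma mult_chains: "f \<otimes>\<^bsub>chains G n\<^esub> g = f + g"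
  and one_chains: "\<one>\<^bsub>chains G n\<^esub> = 0"
  by (auto simp: chains_def subgroup_generated_def product_group_def)

text \<open>The three sums run over three supports. Each is extended by zeros to the union of the
  supports of \<open>f\<close> and \<open>g\<close> in the fibre, which has to be finite.\<close>

lemma pushforward_diff:
  assumes "\<And>z. finite {y \<in> Y. d y = z \<and> f y \<noteq> 0}" "\<And>z. finite {y \<in> Y. d y = z \<and> g y \<noteq> 0}"
  shows "pushforward Y d (f - g) = pushforward Y d f - pushforward Y d g"
proof
  fix z
  let ?F = "{y \<in> Y. d y = z \<and> f y \<noteq> 0}" and ?G = "{y \<in> Y. d y = z \<and> g y \<noteq> 0}"
  have fin: "finite (?F \<union> ?G)"
    using assms by auto
  have *: "pushforward Y d h z = (\<Sum>y\<in>?F \<union> ?G. h y)"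
    if "{y \<in> Y. d y = z \<and> h y \<noteq> 0} \<subseteq> ?F \<union> ?G" for h
    unfolding pushforward_def
    by (rule sum.mono_neutral_left) (use that fin in auto)
  have "pushforward Y d f z = (\<Sum>y\<in>?F \<union> ?G. f y)" "pushforward Y d g z = (\<Sum>y\<in>?F \<union> ?G. g y)"
    "pushforward Y d (f - g) z = (\<Sum>y\<in>?F \<union> ?G. (f - g) y)"
    by (intro *; auto)+
  then show "pushforward Y d (f - g) z = (pushforward Y d f - pushforward Y d g) z"
    by (simp add: sum_subtractf)
qed

lemma pushforward_indicator:
  assumes "B \<subseteq> Y" "inj_on d B"
  shows "pushforward Y d (indicator B) = indicator (d ` B)"
proof
  fix z
  show "pushforward Y d (indicator B) z = indicator (d ` B) z"
  proof (cases "z \<in> d ` B")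
    case True
    then obtain y where "y \<in> B" "z = d y"
      by auto
    then have "{y \<in> Y. d y = z \<and> indicator B y \<noteq> (0::int)} = {y}"
      using assms by (auto simp: indicator_def inj_on_def)
    then show ?thesis
      using True \<open>y \<in> B\<close> by (simp add: pushforward_def)
  next
    case False
    then have "{y \<in> Y. d y = z \<and> indicator B y \<noteq> (0::int)} = {}"
      by (auto simp: indicator_def)
    then show ?thesis
      using False by (simp only: pushforward_def sum.empty) simp
  qed
qed

text \<open>Injectivity of \<open>d\<close> on a generating set lets a fibre meet it in at most one
  point, and a difference is supported in the union of two supports.\<close>

lemma finite_fibre_group_closure:
  assumes "f \<in> group_closure (indicator ` \<B>)" and "\<And>B. B \<in> \<B> \<Longrightarrow> inj_on d B"
  shows "finite {y \<in> Y. d y = z \<and> f y \<noteq> (0::int)}"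
  using assms(1)
proof induction
  case (base f)
  then consider "f = 0" | B where "f = indicator B" "B \<in> \<B>"
    by auto
  then show ?case
  proof cases
    case 2
    have "{y \<in> Y. d y = z \<and> f y \<noteq> 0} \<subseteq> {y \<in> B. d y = z}"
      by (auto simp: 2 indicator_def split: if_splits)
    moreover have "finite {y \<in> B. d y = z}"
      by (rule inj_on_finite[of d _ "{z}"])
        (use assms(2)[OF 2(2)] in \<open>auto simp: inj_on_def\<close>)
    ultimately show ?thesis
      by (rule finite_subset)
  qed auto
next
  case (diff f g)
  have "{y \<in> Y. d y = z \<and> (f - g) y \<noteq> 0} \<subseteq>
      {y \<in> Y. d y = z \<and> f y \<noteq> 0} \<union> {y \<in> Y. d y = z \<and> g y \<noteq> 0}"
    by auto
  then show ?case
    using diff.IH by (meson finite_UnI finite_subset)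
qed

text \<open>The generating family is left open, so that simpler sets with injective faces can take
  the place of \<open>basic_sets\<close>.\<close>

lemma boundary_diff:
  assumes ch: "carrier (chains G n) = group_closure (indicator ` \<B>)"
    and inj: "\<And>B i. B \<in> \<B> \<Longrightarrow> i \<le> n \<Longrightarrow> 0 < n \<Longrightarrow> inj_on (face G n i) B"
    and "f \<in> carrier (chains G n)" "g \<in> carrier (chains G n)"
  shows "boundary G n (f - g) = boundary G n f - boundary G n g"
proof (cases "n = 0")
  case False
  have "pushforward (nerve G n) (face G n i) (f - g) =
      pushforward (nerve G n) (face G n i) f - pushforward (nerve G n) (face G n i) g"
    if "i \<le> n" for i
    by (intro pushforward_diff finite_fibre_group_closure[of _ \<B>])
      (use assms that False in auto)
  then show ?thesis
    using False by (auto simp: boundary_def fun_eq_iff right_diff_distrib sum_subtractf)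
qed (auto simp: boundary_def)

section \<open>A criterion for computing homology\<close>

lemma carrier_cycles:
  "carrier (cycles G n) = {f \<in> carrier (chains G n). boundary G n f = 0}"
  by (simp add: cycles_def kernel_def one_chains)

text \<open>The first isomorphism theorem for \<open>h\<close> on cycles. That the boundaries form a
  subgroup of the cycles is contained in the hypothesis that they are the kernel of
  \<open>h\<close>.\<close>

lemma groupoid_homology_iso:
  fixes H :: "'h monoid"
  assumes H: "group H"
    and diff: "\<And>f g. f \<in> carrier (chains G n) \<Longrightarrow> g \<in> carrier (chains G n) \<Longrightarrow>
      boundary G n (f - g) = boundary G n f - boundary G n g"
    and h: "\<And>f g. f \<in> carrier (cycles G n) \<Longrightarrow> g \<in> carrier (cycles G n) \<Longrightarrow>
      h (f + g) = h f \<otimes>\<^bsub>H\<^esub> h g"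
    and onto: "h ` carrier (cycles G n) = carrier H"
    and kernel: "{f \<in> carrier (cycles G n). h f = \<one>\<^bsub>H\<^esub>} =
      boundary G (Suc n) ` carrier (chains G (Suc n))"
  shows "groupoid_homology G n \<cong> H"
proof -
  let ?Z = "cycles G n"
  have mult: "f \<otimes>\<^bsub>?Z\<^esub> g = f + g" and one: "\<one>\<^bsub>?Z\<^esub> = 0" for f g
    by (simp_all add: cycles_def mult_chains one_chains)
  have zero: "0 \<in> carrier ?Z"
    using diff[of 0 0] by (simp add: carrier_cycles carrier_chains)
  have minus: "f - g \<in> carrier ?Z" if "f \<in> carrier ?Z" "g \<in> carrier ?Z" for f g
    using that diff by (auto simp: carrier_cycles carrier_chains intro: group_closure.diff)
  have neg: "- f \<in> carrier ?Z" if "f \<in> carrier ?Z" for f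
    using minus[OF zero that] by simp
  have Z: "group ?Z"
  proof (rule groupI)
    fix f g assume "f \<in> carrier ?Z" "g \<in> carrier ?Z"
    then show "f \<otimes>\<^bsub>?Z\<^esub> g \<in> carrier ?Z"
      using minus[of f "- g"] neg by (simp add: mult)
  next
    fix f assume "f \<in> carrier ?Z"
    then show "\<exists>g\<in>carrier ?Z. g \<otimes>\<^bsub>?Z\<^esub> f = \<one>\<^bsub>?Z\<^esub>"
      using neg by (intro bexI[of _ "- f"]) (auto simp: mult one)
  qed (auto simp: mult one zero add.assoc)
  have "h \<in> hom ?Z H"
    using h onto by (auto simp: hom_def mult)
  then interpret group_hom ?Z H h
    using Z H by (simp add: group_hom_def group_hom_axioms_def)
  have "kernel ?Z H h = boundary G (Suc n) ` carrier (chains G (Suc n))"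
    using kernel by (simp add: kernel_def)
  then show ?thesis
    using FactGroup_iso[OF onto] by (simp add: groupoid_homology_def)
qed

lemma indicator_disjoint_union:
  assumes "finite I" "\<And>i j x. i \<in> I \<Longrightarrow> j \<in> I \<Longrightarrow> x \<in> A i \<Longrightarrow> x \<in> A j \<Longrightarrow> i = j"
  shows "indicator (\<Union>i\<in>I. A i) = (\<Sum>i\<in>I. indicator (A i) :: 'b \<Rightarrow> int)"
proof
  fix x
  have "indicator (\<Union>i\<in>I. A i) x = (\<Sum>i\<in>I. indicator (A i) x :: int)"
    by (rule indicator_UN_disjoint) (use assms in \<open>auto simp: disjoint_family_on_def\<close>)
  also have "\<dots> = (\<Sum>i\<in>I. indicator (A i) :: 'b \<Rightarrow> int) x"
    using assms(1) by (induction I) auto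
  finally show "indicator (\<Union>i\<in>I. A i) x = (\<Sum>i\<in>I. indicator (A i) :: 'b \<Rightarrow> int) x" .
qed


section \<open>The groupoid of germs of a free homeomorphism\<close>

lemma int_iterate_0 [simp]: "int_iterate f 0 x = x"
  by (simp add: int_iterate_def)

lemma int_iterate_of_nat: "int_iterate f (int n) = f ^^ n"
  by (simp add: int_iterate_def)

lemma int_iterate_Suc:
  assumes "bij f"
  shows "int_iterate f (n + 1) x = f (int_iterate f n x)"
proof (cases "n \<ge> 0")
  case True
  then show ?thesis
    by (simp add: int_iterate_def nat_add_distrib)
next
  case False
  then have "nat (- n) = Suc (nat (- n - 1))"
    by simp
  then show ?thesis
    using False assms by (auto simp: int_iterate_def bij_inv_eq_iff[symmetric] surj_f_inv_f bij_is_surj)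
qed

lemma int_iterate_add:
  assumes "bij f"
  shows "int_iterate f (m + n) x = int_iterate f m (int_iterate f n x)"
proof (induction m rule: int_induct[where k = 0])
  case (step1 i)
  then show ?case
    using int_iterate_Suc[OF assms, of "i + n" x] int_iterate_Suc[OF assms, of i] by (simp add: algebra_simps)
next
  case (step2 i)
  \<comment> \<open>Going down, both sides are compared after one more application of
    \<open>f\<close>, where the forward recursion applies; injectivity removes it again.\<close>
  then have "f (int_iterate f (i - 1 + n) x) = f (int_iterate f (i - 1) (int_iterate f n x))"
    using int_iterate_Suc[OF assms, of "i - 1 + n" x] int_iterate_Suc[OF assms, of "i - 1"]
    by (simp add: algebra_simps)
  then show ?case
    using assms by (simp add: bij_is_inj inj_eq)
qed simp

lemma continuous_on_funpow:
  fixes f :: "'a::topological_space \<Rightarrow> 'a"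
  assumes "continuous_on UNIV f"
  shows "continuous_on UNIV (f ^^ n)"
proof (induction n)
  case 0
  then show ?case
    by (simp add: id_def)
next
  case (Suc n)
  then show ?case
    unfolding funpow.simps using assms by (intro continuous_on_compose) (auto intro: continuous_on_subset)
qed

section \<open>The action and its germs\<close>

text \<open>Compactness and the Hausdorff property act together: they make the inverse of
  \<open>T\<close> continuous, and they make the compact open sets exactly the clopen ones.\<close>

locale free_homeomorphism =
  fixes T :: "'x::t2_space \<Rightarrow> 'x"
  assumes continuous: "continuous_on UNIV T"
    and bij: "bij T"
    and compact: "compact (UNIV :: 'x set)"
    and free: "0 < n \<Longrightarrow> (T ^^ n) x \<noteq> x"
begin

abbreviation act :: "int \<Rightarrow> 'x \<Rightarrow> 'x" where
  "act \<equiv> int_iterate T"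

abbreviation G :: "(int \<times> 'x) set top_groupoid" where
  "G \<equiv> germ_groupoid act"

abbreviation clopen :: "'x set \<Rightarrow> bool" where
  "clopen U \<equiv> open U \<and> closed U"

text \<open>Under a free action the germ of \<open>act n\<close> at \<open>x\<close> is a class with
  a single representative, hence this singleton.\<close>

definition arr :: "int \<Rightarrow> 'x \<Rightarrow> (int \<times> 'x) set" where
  "arr n x = {(n, x)}"

definition base :: "(int \<times> 'x) set \<Rightarrow> 'x" where
  "base g = snd (the_elem g)"

lemma base_arr [simp]: "base (arr n x) = x"
  by (simp add: base_def arr_def)

lemma arr_eq_iff [simp]: "arr m x = arr n y \<longleftrightarrow> m = n \<and> x = y"
  by (simp add: arr_def)

lemma act_add: "act (m + n) x = act m (act n x)"
  by (rule int_iterate_add[OF bij])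

lemma act_1 [simp]: "act 1 x = T x"
  using int_iterate_of_nat[of T 1] by simp

lemma act_cancel [simp]: "act n (act (- n) x) = x" "act (- n) (act n x) = x"
  using act_add[of n "- n" x] act_add[of "- n" n x] by auto

lemma act_fixed: "act n x = x \<longleftrightarrow> n = 0"
proof -
  have *: "m = 0" if "act m x = x" "m \<ge> 0" for m
    using free[of "nat m" x] that int_iterate_of_nat[of T "nat m"] by (cases "m = 0") auto
  have "n = 0" if "act n x = x"
  proof (cases "n \<ge> 0")
    case False
    have "act (- n) x = x"
      by (metis act_cancel(2) that)
    then show ?thesis
      using *[of "- n"] False by simp
  qed (use * that in auto)
  then show ?thesis
    by auto
qed

lemma act_eq_iff: "act m x = act n x \<longleftrightarrow> m = n"
proof -
  have "act m x = act n x \<longleftrightarrow> act (m - n) x = x"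
    by (metis act_add act_cancel(2) add.commute diff_conv_add_uminus act_cancel(1))
  then show ?thesis
    by (simp add: act_fixed)
qed

lemma continuous_act: "continuous_on UNIV (act n)"
proof -
  have "continuous_on (T ` UNIV) (inv_into UNIV T)"
    by (rule continuous_on_inv[OF continuous compact]) (simp add: bij bij_is_inj)
  then have "continuous_on UNIV (inv_into UNIV T)"
    using bij by (simp add: bij_is_surj)
  then show ?thesis
    unfolding int_iterate_def using continuous by (auto intro: continuous_on_funpow)
qed

lemma act_image_eq_vimage: "act n ` U = act (- n) -` U"
  by (auto simp: image_iff) (metis act_cancel(1))

lemma clopen_act_image: "clopen U \<Longrightarrow> clopen (act n ` U)"
  unfolding act_image_eq_vimage using continuous_act by (auto intro: open_vimage closed_vimage)

lemma clopen_imp_compact: "clopen U \<Longrightarrow> compact U"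
  using compact_Int_closed[OF compact, of U] by simp

lemma inj_act: "inj_on (act n) U"
  by (rule inj_on_inverseI[of _ "act (- n)"]) simp

text \<open>Maps that agree near \<open>x\<close> agree at \<open>x\<close>, and freeness recovers
  the exponent from that one value.\<close>

lemma germ_eq: "germ act n x = arr n x"
proof -
  have "h = n" if "\<forall>\<^sub>F z in nhds x. act h z = act n z" for h
    using eventually_nhds_x_imp_x[OF that] by (simp add: act_eq_iff)
  then show ?thesis
    by (auto simp: germ_def arr_def)
qed

lemma gmult_arr: "gmult G (arr m (act n x)) (arr n x) = arr (m + n) x"
  by (auto simp: germ_groupoid_def germ_eq) (auto simp: arr_def)

lemma ginv_arr: "ginv G (arr n x) = arr (- n) (act n x)"
  by (auto simp: germ_groupoid_def germ_eq) (auto simp: arr_def)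

lemma gsource_arr [simp]: "gsource G (arr n x) = arr 0 x"
  using gmult_arr[of "- n" n x] by (simp add: gsource_def ginv_arr)

lemma grange_arr [simp]: "grange G (arr n x) = arr 0 (act n x)"
  using gmult_arr[of n "- n" "act n x"] by (simp add: grange_def ginv_arr)

section \<open>Topology of the arrow space\<close>

lemma arrow_topology_eq:
  "arrow_topology G = topology_generated_by {arr n ` U | n U. open U}"
  by (simp add: germ_groupoid_def germ_eq)

lemma arrows_eq: "arrows G = {arr n x | n x. True}"
  by (auto simp: arrows_def arrow_topology_eq)

lemma gunits_eq: "gunits G = range (arr 0)"
  by (auto simp: gunits_def arrows_eq image_iff) (metis gsource_arr)

text \<open>The arrow space is the disjoint union of copies of the space, one sheet for each
  exponent: a basic open set lies in one sheet and leaves the other slices empty.\<close>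

lemma openin_arrow_iff:
  "openin (arrow_topology G) W \<longleftrightarrow> W \<subseteq> arrows G \<and> (\<forall>n. open {x. arr n x \<in> W})"
proof
  assume W: "openin (arrow_topology G) W"
  then have "generate_topology_on {arr n ` U | n U. open U} W"
    by (simp add: arrow_topology_eq openin_topology_generated_by_iff)
  then have "\<forall>n. open {x. arr n x \<in> W}"
  proof induction
    case (Int a b)
    then show ?case
      by (auto simp: Collect_conj_eq)
  next
    case (UN K)
    have "{x. arr n x \<in> \<Union>K} = (\<Union>k\<in>K. {x. arr n x \<in> k})" for n
      by auto
    then show ?case
      using UN by (auto intro!: open_UN)
  next
    case (Basis s)
    then obtain m U where s: "s = arr m ` U" "open U"
      by auto
    have "{x. arr n x \<in> s} = (if n = m then U else {})" for n
      by (auto simp: s)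
    then show ?case
      using s by simp
  qed simp
  then show "W \<subseteq> arrows G \<and> (\<forall>n. open {x. arr n x \<in> W})"
    using openin_subset[OF W] by (auto simp: arrows_def)
next
  assume W: "W \<subseteq> arrows G \<and> (\<forall>n. open {x. arr n x \<in> W})"
  then have "W = (\<Union>n. arr n ` {x. arr n x \<in> W})"
    by (fastforce simp: arrows_eq)
  moreover have "openin (arrow_topology G) (arr n ` {x. arr n x \<in> W})" for n
    using W unfolding arrow_topology_eq by (intro topology_generated_by_Basis) auto
  ultimately show "openin (arrow_topology G) W"
    by (metis (no_types, lifting) imageE openin_Union)
qed

lemma topspace_arrow: "topspace (arrow_topology G) = arrows G"
  by (simp add: arrows_def)

lemma continuous_map_arr: "continuous_map euclidean (arrow_topology G) (arr n)"
  unfolding continuous_map_def by (auto simp: openin_arrow_iff topspace_arrow arrows_eq)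

lemma continuous_map_base: "continuous_map (arrow_topology G) euclidean base"
proof -
  have "{x. arr n x \<in> {g \<in> arrows G. base g \<in> U}} = U" for n U
    by (auto simp: arrows_eq)
  then show ?thesis
    unfolding continuous_map_def by (auto simp: openin_arrow_iff topspace_arrow)
qed

lemma continuous_map_act: "continuous_map euclidean euclidean (act n)"
  using continuous_act by simp

text \<open>The sheets \<open>range (arr n)\<close> are open, closed, and cover all arrows.
  Closedness makes each slice of \<open>F\<close> compact; a finite subcover leaves finitely many
  exponents.\<close>

lemma compactin_arrow_slice:
  assumes "compactin (arrow_topology G) F"
  shows "compact {x. arr n x \<in> F}" "finite {n. \<exists>x. arr n x \<in> F}"
proof -
  have sub: "F \<subseteq> arrows G"
    using compactin_subset_topspace[OF assms] by (simp add: topspace_arrow)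
  have "closedin (arrow_topology G) (range (arr n))"
  proof -
    have "{x. arr m x \<in> arrows G - range (arr n)} = (if m = n then {} else UNIV)" for m
      by (auto simp: arrows_eq)
    then show ?thesis
      by (auto simp: closedin_def topspace_arrow openin_arrow_iff arrows_eq)
  qed
  then have "compactin (arrow_topology G) (F \<inter> range (arr n))"
    using assms by (meson compactin_subset_topspace closed_Int_compactin inf_commute compact_Int_closedin)
  then have "compactin euclidean (base ` (F \<inter> range (arr n)))"
    by (rule image_compactin[OF _ continuous_map_base])
  moreover have "base ` (F \<inter> range (arr n)) = {x. arr n x \<in> F}"
    by (force simp: image_iff)
  ultimately show "compact {x. arr n x \<in> F}"
    by simp
  have "openin (arrow_topology G) U" if U: "U \<in> range (\<lambda>n. range (arr n))" for U
  proof -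
    obtain m where "U = range (arr m)"
      using U by auto
    then have "{x. arr k x \<in> U} = (if k = m then UNIV else {})" for k
      by auto
    then show ?thesis
      using \<open>U = range (arr m)\<close> by (auto simp: openin_arrow_iff arrows_eq)
  qed
  moreover have "F \<subseteq> \<Union> (range (\<lambda>n. range (arr n)))"
    using sub by (fastforce simp: arrows_eq)
  ultimately obtain \<F> where "finite \<F>" "\<F> \<subseteq> range (\<lambda>n. range (arr n))" "F \<subseteq> \<Union>\<F>"
    using assms unfolding compactin_def by meson
  then obtain N where "finite N" "F \<subseteq> (\<Union>n\<in>N. range (arr n))"
    using finite_subset_image[of \<F> "\<lambda>n. range (arr n)" UNIV] by auto
  then have "{n. \<exists>x. arr n x \<in> F} \<subseteq> N"
    by auto
  then show "finite {n. \<exists>x. arr n x \<in> F}"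
    using \<open>finite N\<close> finite_subset by blast
qed

lemma clopen_arrow_slice:
  assumes "openin (arrow_topology G) F" "compactin (arrow_topology G) F"
  shows "clopen {x. arr n x \<in> F}"
  using assms compactin_arrow_slice(1)[of F n] by (auto simp: openin_arrow_iff compact_imp_closed)

lemma openin_arr_image: "open U \<Longrightarrow> openin (arrow_topology G) (arr n ` U)"
proof -
  have "{x. arr k x \<in> arr n ` U} = (if k = n then U else {})" for k
    by auto
  then show "open U \<Longrightarrow> openin (arrow_topology G) (arr n ` U)"
    by (auto simp: openin_arrow_iff arrows_eq)
qed

lemma compactin_arr_image: "compact U \<Longrightarrow> compactin (arrow_topology G) (arr n ` U)"
  by (rule image_compactin[OF _ continuous_map_arr]) simp

lemma compact_open_bisection_arr:
  assumes "clopen U"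
  shows "compact_open_bisection G (arr n ` U)"
proof -
  \<comment> \<open>Source and range are treated at once: both send \<open>arr n x\<close> to
    \<open>arr 0 (act k x)\<close>, with \<open>k = 0\<close> and \<open>k = n\<close>, and are
    inverted by applying \<open>act (- k)\<close> to the base point.\<close>
  have "homeomorphic_map (subtopology (arrow_topology G) (arr n ` U))
      (subtopology (unit_topology G) (f ` arr n ` U)) f"
    if f: "\<And>x. f (arr n x) = arr 0 (act k x)" for f k
  proof -
    let ?X = "subtopology (arrow_topology G) (arr n ` U)"
    let ?Y = "subtopology (unit_topology G) (f ` arr n ` U)"
    have X: "topspace ?X = arr n ` U"
      by (auto simp: topspace_arrow arrows_eq)
    have "f ` arr n ` U = (\<lambda>x. arr 0 (act k x)) ` U"
      by (auto simp: f image_image)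
    then have Y: "topspace ?Y = (\<lambda>x. arr 0 (act k x)) ` U"
      by (auto simp: unit_topology_def topspace_arrow arrows_eq gunits_eq)
    have "continuous_map (arrow_topology G) (arrow_topology G) (\<lambda>g. arr m (act j (base g)))" for m j
      using continuous_map_compose[OF continuous_map_compose[OF continuous_map_base continuous_map_act] continuous_map_arr]
      by (simp add: comp_def)
    then have c: "continuous_map (subtopology (arrow_topology G) S) (arrow_topology G) (\<lambda>g. arr m (act j (base g)))" for m j S
      by (rule continuous_map_from_subtopology)
    have "continuous_map ?X (arrow_topology G) f"
      by (rule continuous_map_eq[OF c[of _ 0 k]]) (use f X in auto)
    then have cf: "continuous_map ?X ?Y f"
      using f X by (auto simp: unit_topology_def continuous_map_in_subtopology gunits_eq)
    have "continuous_map ?Y (arrow_topology G) (\<lambda>g. arr n (act (- k) (base g)))"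
      unfolding unit_topology_def subtopology_subtopology by (rule c)
    then have cg: "continuous_map ?Y ?X (\<lambda>g. arr n (act (- k) (base g)))"
      unfolding continuous_map_in_subtopology[of ?Y] Y by (auto simp: Pi_iff)
    have "homeomorphic_maps ?X ?Y f (\<lambda>g. arr n (act (- k) (base g)))"
      unfolding homeomorphic_maps_def X Y using cf cg f by auto
    then show ?thesis
      by (rule homeomorphic_maps_imp_map)
  qed
  from this[of "gsource G" 0] this[of "grange G" n] show ?thesis
    unfolding compact_open_bisection_def using assms
    by (simp add: openin_arr_image compactin_arr_image clopen_imp_compact)
qed

section \<open>Nerve and chains in degrees 0, 1 and 2\<close>

definition slice :: "int \<Rightarrow> 'x set \<Rightarrow> (int \<times> 'x) set list set" where
  "slice n U = (\<lambda>x. [arr n x]) ` U"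

text \<open>A composable pair is parametrised by the base point of its right-hand arrow, which is
  applied first; its left-hand arrow then starts at \<open>act n x\<close>.\<close>

definition slice2 :: "int \<Rightarrow> int \<Rightarrow> 'x set \<Rightarrow> (int \<times> 'x) set list set" where
  "slice2 m n U = (\<lambda>x. [arr m (act n x), arr n x]) ` U"

lemma nerve_1: "nerve G 1 = {[arr n x] | n x. True}"
  by (auto simp: nerve_def arrows_eq length_Suc_conv)

lemma nerve_2: "nerve G 2 = {[arr m (act n x), arr n x] | m n x. True}"
proof -
  have "gs \<in> nerve G 2 \<longleftrightarrow> (\<exists>m n y x. gs = [arr m y, arr n x] \<and> y = act n x)" for gs
    by (auto simp: nerve_def arrows_eq length_Suc_conv numeral_2_eq_2 nth_Cons' less_Suc_eq)
  then show ?thesis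
    by auto
qed

lemma basic_sets_0: "basic_sets G 0 = {slice 0 U | U. clopen U}"
proof -
  have o: "openin (arrow_topology G) (range (arr 0))"
    by (rule openin_arr_image) simp
  have "openin (unit_topology G) V \<and> compactin (unit_topology G) V \<longleftrightarrow> (\<exists>U. V = arr 0 ` U \<and> clopen U)" for V
  proof
    assume V: "openin (unit_topology G) V \<and> compactin (unit_topology G) V"
    then have "V \<subseteq> range (arr 0)"
      "openin (arrow_topology G) V" "compactin (arrow_topology G) V"
      by (auto simp: unit_topology_def gunits_eq openin_open_subtopology[OF o] compactin_subtopology)
    then have "V = arr 0 ` {x. arr 0 x \<in> V}" "clopen {x. arr 0 x \<in> V}"
      by (auto intro!: clopen_arrow_slice)
    then show "\<exists>U. V = arr 0 ` U \<and> clopen U"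
      by blast
  next
    assume "\<exists>U. V = arr 0 ` U \<and> clopen U"
    then show "openin (unit_topology G) V \<and> compactin (unit_topology G) V"
      by (auto simp: unit_topology_def gunits_eq openin_open_subtopology[OF o] compactin_subtopology
          openin_arr_image compactin_arr_image clopen_imp_compact)
  qed
  then have "basic_sets G 0 = {(\<lambda>u. [u]) ` V | V. \<exists>U. V = arr 0 ` U \<and> clopen U}"
    by (simp add: basic_sets_def)
  also have "\<dots> = {(\<lambda>u. [u]) ` arr 0 ` U | U. clopen U}"
    by blast
  finally show ?thesis
    unfolding slice_def image_image .
qed

lemma chains_0: "carrier (chains G 0) = group_closure (indicator ` {slice 0 U | U. clopen U})"
  by (simp add: carrier_chains basic_sets_0)

text \<open>A compact open set of arrows is a finite disjoint union of slices over clopen sets, and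
  each such slice is itself a compact open bisection.\<close>

lemma chains_1: "carrier (chains G 1) = group_closure (indicator ` {slice n U | n U. clopen U})"
  (is "_ = group_closure (indicator ` ?S)")
  unfolding carrier_chains
proof (intro equalityI group_closure_mono subsetI)
  fix f :: "(int \<times> 'x) set list \<Rightarrow> int" assume "f \<in> indicator ` basic_sets G 1"
  then obtain Fs where f: "f = indicator {gs \<in> nerve G 1. \<forall>i<1. gs ! i \<in> Fs ! i}"
    and Fs: "length Fs = 1" "\<forall>F\<in>set Fs. compact_open_bisection G F"
    unfolding basic_sets_def by auto
  define F where "F = Fs ! 0"
  have F: "openin (arrow_topology G) F" "compactin (arrow_topology G) F"
    using Fs by (auto simp: F_def compact_open_bisection_def)
  let ?N = "{n. \<exists>x. arr n x \<in> F}"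
  have "{gs \<in> nerve G 1. \<forall>i<1. gs ! i \<in> Fs ! i} = (\<Union>n\<in>?N. slice n {x. arr n x \<in> F})"
  proof (intro equalityI subsetI)
    fix gs assume "gs \<in> {gs \<in> nerve G 1. \<forall>i<1. gs ! i \<in> Fs ! i}"
    then have "gs \<in> nerve G 1" "gs ! 0 \<in> F"
      unfolding F_def by auto
    then obtain n x where "gs = [arr n x]" "arr n x \<in> F"
      unfolding nerve_1 by auto
    then show "gs \<in> (\<Union>n\<in>?N. slice n {x. arr n x \<in> F})"
      unfolding slice_def by blast
  next
    fix gs assume "gs \<in> (\<Union>n\<in>?N. slice n {x. arr n x \<in> F})"
    then obtain n x where "gs = [arr n x]" "arr n x \<in> F"
      unfolding slice_def by auto
    then show "gs \<in> {gs \<in> nerve G 1. \<forall>i<1. gs ! i \<in> Fs ! i}"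
      unfolding nerve_1 F_def by auto
  qed
  then have "f = (\<Sum>n\<in>?N. indicator (slice n {x. arr n x \<in> F}))"
    unfolding f by (simp only:) (rule indicator_disjoint_union, rule compactin_arrow_slice(2)[OF F(2)], auto simp: slice_def)
  moreover have "(indicator (slice n {x. arr n x \<in> F}) :: _ \<Rightarrow> int) \<in> group_closure (indicator ` ?S)" for n
    using clopen_arrow_slice[OF F] by (intro group_closure_incl imageI) blast
  ultimately show "f \<in> group_closure (indicator ` ?S)"
    by (simp only:) (rule group_closure_sum)
next
  fix f :: "(int \<times> 'x) set list \<Rightarrow> int" assume "f \<in> indicator ` ?S"
  then obtain n U where f: "f = indicator (slice n U)" and U: "clopen U"
    by auto
  have "slice n U = {gs \<in> nerve G 1. \<forall>i<1. gs ! i \<in> [arr n ` U] ! i}"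
    unfolding nerve_1 slice_def by auto
  then have "slice n U \<in> basic_sets G 1"
    using compact_open_bisection_arr[OF U, of n]
    unfolding basic_sets_def by (auto intro!: exI[of _ "[arr n ` U]"])
  then show "f \<in> group_closure (indicator ` basic_sets G 1)"
    unfolding f by (intro group_closure_incl imageI)
qed

text \<open>Fixing the exponents of both arrows splits a basic set into finitely many disjoint
  pieces, each given by a clopen set of base points.\<close>

lemma chains_2: "carrier (chains G 2) = group_closure (indicator ` {slice2 m n U | m n U. clopen U})"
  (is "_ = group_closure (indicator ` ?S)")
  unfolding carrier_chains
proof (intro equalityI group_closure_mono subsetI)
  fix f :: "(int \<times> 'x) set list \<Rightarrow> int" assume "f \<in> indicator ` basic_sets G 2"
  then obtain Fs where f: "f = indicator {gs \<in> nerve G 2. \<forall>i<2. gs ! i \<in> Fs ! i}"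
    and Fs: "length Fs = 2" "\<forall>F\<in>set Fs. compact_open_bisection G F"
    unfolding basic_sets_def by auto
  define F where "F = Fs ! 0"
  define F' where "F' = Fs ! 1"
  have F: "openin (arrow_topology G) F" "compactin (arrow_topology G) F"
    and F': "openin (arrow_topology G) F'" "compactin (arrow_topology G) F'"
    using Fs by (auto simp: F_def F'_def compact_open_bisection_def)
  let ?N = "{n. \<exists>x. arr n x \<in> F} \<times> {n. \<exists>x. arr n x \<in> F'}"
  let ?U = "\<lambda>(m, n). act n -` {x. arr m x \<in> F} \<inter> {x. arr n x \<in> F'}"
  have "{gs \<in> nerve G 2. \<forall>i<2. gs ! i \<in> Fs ! i} = (\<Union>(m, n)\<in>?N. slice2 m n (?U (m, n)))"
  proof (intro equalityI subsetI)
    fix gs assume "gs \<in> {gs \<in> nerve G 2. \<forall>i<2. gs ! i \<in> Fs ! i}"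
    then have "gs \<in> nerve G 2" "gs ! 0 \<in> F" "gs ! 1 \<in> F'"
      unfolding F_def F'_def by auto
    then obtain m n x where "gs = [arr m (act n x), arr n x]" "arr m (act n x) \<in> F" "arr n x \<in> F'"
      unfolding nerve_2 by auto
    then show "gs \<in> (\<Union>(m, n)\<in>?N. slice2 m n (?U (m, n)))"
      unfolding slice2_def by (intro UN_I[of "(m, n)"]) auto
  next
    fix gs assume "gs \<in> (\<Union>(m, n)\<in>?N. slice2 m n (?U (m, n)))"
    then obtain m n x where "gs = [arr m (act n x), arr n x]" "arr m (act n x) \<in> F" "arr n x \<in> F'"
      unfolding slice2_def by auto
    then show "gs \<in> {gs \<in> nerve G 2. \<forall>i<2. gs ! i \<in> Fs ! i}"
      unfolding nerve_2 F_def F'_def by (auto simp: less_2_cases_iff)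
  qed
  then have "{gs \<in> nerve G 2. \<forall>i<2. gs ! i \<in> Fs ! i} = (\<Union>p\<in>?N. slice2 (fst p) (snd p) (?U p))"
    by (simp add: split_def)
  then have "f = (\<Sum>p\<in>?N. indicator (slice2 (fst p) (snd p) (?U p)))"
    unfolding f by (simp only:) (rule indicator_disjoint_union,
        use F(2) F'(2) compactin_arrow_slice(2) in blast, auto simp: slice2_def)
  moreover have "clopen (?U p)" for p
    using clopen_arrow_slice[OF F] clopen_arrow_slice[OF F'] continuous_act
    unfolding split_def by (intro conjI open_Int closed_Int open_vimage closed_vimage) auto
  then have "(indicator (slice2 (fst p) (snd p) (?U p)) :: _ \<Rightarrow> int) \<in> group_closure (indicator ` ?S)" for p
    by (intro group_closure_incl imageI) blast
  ultimately show "f \<in> group_closure (indicator ` ?S)"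
    by (simp only:) (rule group_closure_sum)
next
  fix f :: "(int \<times> 'x) set list \<Rightarrow> int" assume "f \<in> indicator ` ?S"
  then obtain m n U where f: "f = indicator (slice2 m n U)" and U: "clopen U"
    by auto
  \<comment> \<open>The left bisection lies over the image of \<open>U\<close> under
    \<open>act n\<close>, so that its sources are exactly the ranges of the right one.\<close>
  let ?Fs = "[arr m ` act n ` U, arr n ` U]"
  have "slice2 m n U = {gs \<in> nerve G 2. \<forall>i<2. gs ! i \<in> ?Fs ! i}"
  proof (intro equalityI subsetI)
    fix gs assume "gs \<in> {gs \<in> nerve G 2. \<forall>i<2. gs ! i \<in> ?Fs ! i}"
    then have "gs \<in> nerve G 2" "gs ! 0 \<in> arr m ` act n ` U" "gs ! 1 \<in> arr n ` U"
      by (auto dest: spec[of _ 0] spec[of _ 1])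
    then show "gs \<in> slice2 m n U"
      unfolding nerve_2 slice2_def by (auto intro: rev_image_eqI)
  qed (auto simp: nerve_2 slice2_def less_2_cases_iff)
  moreover have "\<forall>i. Suc i < 2 \<longrightarrow> gsource G ` (?Fs ! i) = grange G ` (?Fs ! Suc i)"
    by (auto simp: image_image)
  moreover have "\<forall>F\<in>set ?Fs. compact_open_bisection G F"
    using compact_open_bisection_arr[OF U, of n] compact_open_bisection_arr[OF clopen_act_image[OF U], of m n]
    by simp
  ultimately have "slice2 m n U \<in> {{gs \<in> nerve G 2. \<forall>i<2. gs ! i \<in> Fs ! i} | Fs.
      length Fs = 2 \<and> (\<forall>F\<in>set Fs. compact_open_bisection G F) \<and>
      (\<forall>i. Suc i < 2 \<longrightarrow> gsource G ` (Fs ! i) = grange G ` (Fs ! Suc i))}"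
    by (intro CollectI exI[of _ ?Fs] conjI) simp_all
  then have "slice2 m n U \<in> basic_sets G 2"
    by (simp add: basic_sets_def)
  then show "f \<in> group_closure (indicator ` basic_sets G 2)"
    unfolding f by (intro group_closure_incl imageI)
qed

section \<open>Boundary maps on slices\<close>

lemma face_1_image: "face G 1 0 ` slice n U = slice 0 (act n ` U)" "face G 1 1 ` slice n U = slice 0 U"
  by (auto simp: face_def slice_def image_image)

lemma face_1_inj: "i \<le> 1 \<Longrightarrow> inj_on (face G 1 i) (slice n U)"
  using inj_act[of n U] by (auto simp: inj_on_def face_def slice_def)

lemma face_2_image: "face G 2 0 ` slice2 m n U = slice n U" "face G 2 1 ` slice2 m n U = slice (m + n) U"
  "face G 2 2 ` slice2 m n U = slice m (act n ` U)"
  by (auto simp: face_def slice_def slice2_def image_image gmult_arr)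

lemma face_2_inj: "i \<le> 2 \<Longrightarrow> inj_on (face G 2 i) (slice2 m n U)"
  using inj_act[of n U] by (auto simp: inj_on_def face_def slice2_def gmult_arr)

lemma boundary_1_slice:
  "boundary G 1 (indicator (slice n U)) = indicator (slice 0 (act n ` U)) - indicator (slice 0 U)"
proof -
  have "pushforward (nerve G 1) (face G 1 i) (indicator (slice n U)) = indicator (face G 1 i ` slice n U)"
    if "i \<le> 1" for i
    using that by (intro pushforward_indicator face_1_inj) (auto simp: nerve_1[unfolded One_nat_def] slice_def)
  then show ?thesis
    using face_1_image[of n U] by (auto simp: boundary_def fun_eq_iff)
qed

text \<open>Read modulo boundaries, this breaks an arrow of exponent \<open>m + n\<close> into its
  two factors; it is the only relation between slices in degree 1.\<close>

lemma boundary_2_slice: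
  "boundary G 2 (indicator (slice2 m n U)) =
     indicator (slice n U) - indicator (slice (m + n) U) + indicator (slice m (act n ` U))"
proof -
  have "pushforward (nerve G 2) (face G 2 i) (indicator (slice2 m n U)) = indicator (face G 2 i ` slice2 m n U)"
    if "i \<le> 2" for i
    using that by (intro pushforward_indicator face_2_inj) (auto simp: nerve_2 slice2_def)
  from this[of 0] this[of 1] this[of 2] show ?thesis
    unfolding face_2_image by (simp add: boundary_def fun_eq_iff numeral_2_eq_2)
qed

lemma boundary_1_diff:
  assumes "f \<in> carrier (chains G 1)" "g \<in> carrier (chains G 1)"
  shows "boundary G 1 (f - g) = boundary G 1 f - boundary G 1 g"
  by (rule boundary_diff[OF chains_1 _ assms]) (use face_1_inj in auto)

lemma boundary_2_diff:
  assumes "f \<in> carrier (chains G 2)" "g \<in> carrier (chains G 2)"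
  shows "boundary G 2 (f - g) = boundary G 2 f - boundary G 2 g"
  by (rule boundary_diff[OF chains_2 _ assms]) (use face_2_inj in auto)

lemma boundary_1_image:
  "boundary G 1 ` carrier (chains G 1) =
     group_closure {indicator (slice 0 (act n ` U)) - indicator (slice 0 U) | n U. clopen U}"
proof -
  have "boundary G 1 ` carrier (chains G 1) =
      group_closure (boundary G 1 ` indicator ` {slice n U | n U. clopen U})"
    unfolding chains_1 by (rule image_group_closure, rule boundary_1_diff; simp only: chains_1)
  also have "boundary G 1 ` indicator ` {slice n U | n U. clopen U} =
      {boundary G 1 (indicator (slice n U)) | n U. clopen U}"
    by blast
  also have "\<dots> = {indicator (slice 0 (act n ` U)) - indicator (slice 0 U) | n U. clopen U}"
    by (simp only: boundary_1_slice)
  finally show ?thesis .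
qed

lemma boundary_2_image:
  "boundary G 2 ` carrier (chains G 2) =
     group_closure {indicator (slice n U) - indicator (slice (m + n) U) + indicator (slice m (act n ` U)) | m n U. clopen U}"
proof -
  have "boundary G 2 ` carrier (chains G 2) =
      group_closure (boundary G 2 ` indicator ` {slice2 m n U | m n U. clopen U})"
    unfolding chains_2 by (rule image_group_closure, rule boundary_2_diff; simp only: chains_2)
  also have "boundary G 2 ` indicator ` {slice2 m n U | m n U. clopen U} =
      {boundary G 2 (indicator (slice2 m n U)) | m n U. clopen U}"
    by blast
  also have "\<dots> = {indicator (slice n U) - indicator (slice (m + n) U) + indicator (slice m (act n ` U)) | m n U. clopen U}"
    by (simp only: boundary_2_slice)
  finally show ?thesis .
qed


subsection \<open>Homology in degrees 0 and 1\<close>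

text \<open>By compactness a locally constant integer function has finitely many values, all with
  clopen level sets, so this span contains all of them. The form as a span matches that of the chain
  groups.\<close>

definition locally_constant :: "('x \<Rightarrow> int) set" where
  "locally_constant = group_closure (indicator ` {U. clopen U})"

text \<open>Chains of degree 0 and 1 both live on one-element lists. Hence one map serves both
  degrees: \<open>lift 0\<close> gives all chains of degree 0, and every \<open>lift n\<close> gives
  chains of degree 1.\<close>

definition lift :: "int \<Rightarrow> ('x \<Rightarrow> int) \<Rightarrow> (int \<times> 'x) set list \<Rightarrow> int" where
  "lift n g gs = (if gs \<in> slice n UNIV then g (base (hd gs)) else 0)"

lemma lift_arr [simp]: "lift n g [arr m x] = (if m = n then g x else 0)"
  by (auto simp: lift_def slice_def)

lemma lift_diff: "lift n (f - g) = lift n f - lift n g"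
  and lift_add: "lift n (f + g) = lift n f + lift n g"
  and lift_zero: "lift n 0 = 0"
  by (auto simp: lift_def fun_eq_iff)

lemma lift_indicator: "lift n (indicator U) = indicator (slice n U)"
  by (auto simp: lift_def slice_def indicator_def fun_eq_iff)

lemma lift_eq_iff: "lift n f = lift n g \<longleftrightarrow> f = g"
proof
  assume *: "lift n f = lift n g"
  show "f = g"
  proof
    fix x
    show "f x = g x"
      using fun_cong[OF *, of "[arr n x]"] by simp
  qed
qed simp

lemma lift_image_group_closure: "lift n ` group_closure S = group_closure (lift n ` S)"
  by (rule image_group_closure) (rule lift_diff)

lemma indicator_in_locally_constant: "clopen U \<Longrightarrow> indicator U \<in> locally_constant"
  unfolding locally_constant_def by (intro group_closure_incl imageI) simp

lemma locally_constant_diff: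
  "f \<in> locally_constant \<Longrightarrow> g \<in> locally_constant \<Longrightarrow> f - g \<in> locally_constant"
  unfolding locally_constant_def by (rule group_closure.diff)

lemma locally_constant_add:
  "f \<in> locally_constant \<Longrightarrow> g \<in> locally_constant \<Longrightarrow> f + g \<in> locally_constant"
  unfolding locally_constant_def by (rule group_closure_add)

lemma locally_constant_zero: "0 \<in> locally_constant"
  unfolding locally_constant_def by (rule zero_in_group_closure)

lemma locally_constant_const: "(\<lambda>_. c) \<in> locally_constant"
proof -
  have UNIV: "indicator UNIV \<in> locally_constant"
    by (rule indicator_in_locally_constant) simp
  show ?thesis
  proof (induction c rule: int_induct[where k = 0])
    case base
    then show ?case
      using locally_constant_zero by (simp add: zero_fun_def)
  next
    case (step1 i)
    have "(\<lambda>_. i + 1) = (\<lambda>_. i) + (indicator UNIV :: 'x \<Rightarrow> int)"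
      by auto
    then show ?case
      using locally_constant_add[OF step1(2) UNIV] by simp
  next
    case (step2 i)
    have "(\<lambda>_. i - 1) = (\<lambda>_. i) - (indicator UNIV :: 'x \<Rightarrow> int)"
      by auto
    then show ?case
      using locally_constant_diff[OF step2(2) UNIV] by simp
  qed
qed

lemma indicator_act_image: "indicator (act n ` U) = indicator U \<circ> act (- n)"
  unfolding act_image_eq_vimage by (auto simp: indicator_def)

lemma lift_0_image: "lift 0 ` locally_constant = carrier (chains G 0)"
proof -
  have "lift 0 ` indicator ` {U. clopen U} = indicator ` {slice 0 U | U. clopen U}"
    by (simp only: setcompr_eq_image image_image lift_indicator)
  then show ?thesis
    unfolding locally_constant_def chains_0 lift_image_group_closure by simp
qed

lemma lift_in_chains_1: "g \<in> locally_constant \<Longrightarrow> lift n g \<in> carrier (chains G 1)"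
proof -
  have "lift n ` indicator ` {U. clopen U} \<subseteq> group_closure (indicator ` {slice n U | n U. clopen U})"
    unfolding image_image lift_indicator by (blast intro: group_closure_incl)
  then have "lift n ` locally_constant \<subseteq> carrier (chains G 1)"
    unfolding locally_constant_def chains_1 lift_image_group_closure by (rule group_closure_mono)
  then show "g \<in> locally_constant \<Longrightarrow> lift n g \<in> carrier (chains G 1)"
    by auto
qed

text \<open>The translate of a set by \<open>act n\<close> is reached in unit steps, and each unit
  step changes the indicator by a coboundary of \<open>T\<close>; the differences telescope.\<close>

lemma coboundaries_eq:
  "{(g \<circ> T) - g | g. g \<in> locally_constant} =
     group_closure {indicator (act n ` U) - indicator U | n U. clopen U}"
  (is "?B = group_closure ?S")
proof (rule equalityI)
  have "(g \<circ> T) - g \<in> group_closure ?S" if "g \<in> locally_constant" for g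
    using that unfolding locally_constant_def
  proof induction
    case (base g)
    then consider "g = 0" | U where "g = indicator U" "clopen U"
      by auto
    then show ?case
    proof cases
      case 1
      then have "(g \<circ> T) - g = 0"
        by auto
      then show ?thesis
        by (simp only: zero_in_group_closure)
    next
      case (2 U)
      have "(g \<circ> T) - g = indicator (act (- 1) ` U) - indicator U"
        unfolding indicator_act_image 2 by (auto simp: fun_eq_iff)
      then show ?thesis
        using 2(2) by (simp only:) (blast intro: group_closure_incl)
    qed
  next
    case (diff f g)
    have "((f - g) \<circ> T) - (f - g) = ((f \<circ> T) - f) - ((g \<circ> T) - g)"
      by auto
    then show ?case
      using diff.IH by (simp only: group_closure.diff)
  qed
  then show "?B \<subseteq> group_closure ?S"
    by blast
next
  have diff: "f - g \<in> ?B" if fg: "f \<in> ?B" "g \<in> ?B" for f g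
  proof -
    obtain f' g' where "f = (f' \<circ> T) - f'" "g = (g' \<circ> T) - g'" "f' \<in> locally_constant" "g' \<in> locally_constant"
      using fg by blast
    moreover from this have "f - g = ((f' - g') \<circ> T) - (f' - g')"
      by auto
    ultimately show ?thesis
      using locally_constant_diff by blast
  qed
  have zero: "0 \<in> ?B"
  proof -
    have "0 = (0 \<circ> T) - (0 :: 'x \<Rightarrow> int)"
      by auto
    then show ?thesis
      using locally_constant_zero by blast
  qed
  have step: "indicator (act (n + 1) ` U) - indicator (act n ` U) \<in> ?B" if "clopen U" for n U
  proof -
    \<comment> \<open>Composition with \<open>T\<close> turns the translate by \<open>n + 1\<close>
      into the translate by \<open>n\<close>, which is why the sign is negative.\<close>
    let ?g = "0 - indicator (act (n + 1) ` U) :: 'x \<Rightarrow> int"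
    have "act (- (n + 1)) (T x) = act (- n) x" for x
      using act_add[of "- (n + 1)" 1 x] by simp
    then have "indicator (act (n + 1) ` U) - indicator (act n ` U) = (?g \<circ> T) - ?g"
      unfolding indicator_act_image by (auto simp: fun_eq_iff)
    moreover have "?g \<in> locally_constant"
      using that by (intro locally_constant_diff locally_constant_zero indicator_in_locally_constant clopen_act_image)
    ultimately show ?thesis
      by blast
  qed
  have "indicator (act n ` U) - indicator U \<in> ?B" if "clopen U" for n U
  proof (induction n rule: int_induct[where k = 0])
    case base
    have "indicator (act 0 ` U) - indicator U = (0 :: 'x \<Rightarrow> int)"
      by auto
    then show ?case
      using zero by (simp only:)
  next
    case (step1 i)
    have "indicator (act (i + 1) ` U) - indicator U =
        (indicator (act i ` U) - indicator U) - (0 - (indicator (act (i + 1) ` U) - indicator (act i ` U)) :: 'x \<Rightarrow> int)"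
      by auto
    then show ?case
      using diff[OF step1(2) diff[OF zero step[OF that, of i]]] by (simp only:)
  next
    case (step2 i)
    have "indicator (act (i - 1) ` U) - indicator U =
        (indicator (act i ` U) - indicator U) - (indicator (act i ` U) - indicator (act (i - 1) ` U) :: 'x \<Rightarrow> int)"
      by auto
    then show ?case
      using diff[OF step2(2) step[OF that, of "i - 1", unfolded diff_add_cancel]] by (simp only:)
  qed
  then show "group_closure ?S \<subseteq> ?B"
    by (intro group_closure_subsetI diff zero) auto
qed

section \<open>Homology in degree 0\<close>

theorem homology_0_iso:
  fixes H :: "'h monoid"
  assumes H: "group H"
    and h: "\<And>f g. f \<in> locally_constant \<Longrightarrow> g \<in> locally_constant \<Longrightarrow> h (f + g) = h f \<otimes>\<^bsub>H\<^esub> h g"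
    and onto: "h ` locally_constant = carrier H"
    and kernel: "{f \<in> locally_constant. h f = \<one>\<^bsub>H\<^esub>} = {(g \<circ> T) - g | g. g \<in> locally_constant}"
  shows "groupoid_homology G 0 \<cong> H"
proof (rule groupoid_homology_iso[OF H])
  \<comment> \<open>All chains of degree 0 are cycles; \<open>r\<close> reads them back as functions
    on the space and inverts \<open>lift 0\<close>.\<close>
  define r :: "((int \<times> 'x) set list \<Rightarrow> int) \<Rightarrow> 'x \<Rightarrow> int" where "r f x = f [arr 0 x]" for f x
  have r: "r (lift 0 g) = g" "r (f + f') = r f + r f'" for g f f'
    by (auto simp: r_def)
  have Z: "carrier (cycles G 0) = lift 0 ` locally_constant"
    unfolding lift_0_image by (auto simp: carrier_cycles boundary_def)
  show "boundary G 0 (f - g) = boundary G 0 f - boundary G 0 g" for f g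
    by (auto simp: boundary_def)
  show "(h \<circ> r) (f + g) = (h \<circ> r) f \<otimes>\<^bsub>H\<^esub> (h \<circ> r) g"
    if "f \<in> carrier (cycles G 0)" "g \<in> carrier (cycles G 0)" for f g
    using that h by (auto simp: Z r)
  show "(h \<circ> r) ` carrier (cycles G 0) = carrier H"
    by (simp add: Z image_image r onto)
  have "{f \<in> carrier (cycles G 0). (h \<circ> r) f = \<one>\<^bsub>H\<^esub>} = lift 0 ` {f \<in> locally_constant. h f = \<one>\<^bsub>H\<^esub>}"
    by (auto simp: Z r)
  also have "\<dots> = group_closure (lift 0 ` {indicator (act n ` U) - indicator U | n U. clopen U})"
    by (simp only: kernel coboundaries_eq lift_image_group_closure)
  also have "lift 0 ` {indicator (act n ` U) - indicator U | n U. clopen U} =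
      {lift 0 (indicator (act n ` U) - indicator U) | n U. clopen U}"
    by blast
  also have "\<dots> = {indicator (slice 0 (act n ` U)) - indicator (slice 0 U) | n U. clopen U}"
    by (simp only: lift_diff lift_indicator)
  finally show "{f \<in> carrier (cycles G 0). (h \<circ> r) f = \<one>\<^bsub>H\<^esub>} =
      boundary G (Suc 0) ` carrier (chains G (Suc 0))"
    using boundary_1_image by simp
qed

section \<open>Unit steps along orbits and homology in degree 1\<close>

text \<open>For \<open>F\<close> the indicator of \<open>U\<close>, this counts the unit steps
  starting at \<open>x\<close> in the paths of length \<open>n\<close> from \<open>U\<close>. These
  steps start in the translates of \<open>U\<close>, whence the negative powers. For negative
  \<open>n\<close> they are traversed backwards and count negatively.\<close>

definition orbit_sum :: "int \<Rightarrow> ('x \<Rightarrow> int) \<Rightarrow> 'x \<Rightarrow> int" where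
  "orbit_sum n F x = (\<Sum>k\<in>{0..<n}. F (act (- k) x)) - (\<Sum>k\<in>{n..<0}. F (act (- k) x))"

lemma orbit_sum_simps:
  "orbit_sum 0 F = 0"
  "orbit_sum (n + 1) F x = orbit_sum n F x + F (act (- n) x)"
  "orbit_sum 1 F = F"
  "orbit_sum n (F - F') = orbit_sum n F - orbit_sum n F'"
proof -
  show 0: "orbit_sum 0 F = 0"
    by (auto simp: orbit_sum_def)
  show 1: "orbit_sum (n + 1) F x = orbit_sum n F x + F (act (- n) x)" for n x
  proof (cases "n \<ge> 0")
    case True
    then have "{0..<n + 1} = insert n {0..<n}"
      by auto
    then show ?thesis
      using True by (simp add: orbit_sum_def)
  next
    case False
    then have "{n..<0} = insert n {n + 1..<0}"
      by auto
    then show ?thesis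
      using False by (simp add: orbit_sum_def)
  qed
  show "orbit_sum 1 F = F"
    using 1[of 0] by (auto simp: 0)
  show "orbit_sum n (F - F') = orbit_sum n F - orbit_sum n F'"
    by (auto simp: orbit_sum_def sum_subtractf)
qed

text \<open>The cocycle identity, valid for all signs. It mirrors the relation given by boundaries
  from degree 2, so it makes \<open>transfer\<close> vanish on them.\<close>

lemma orbit_sum_add: "orbit_sum (m + n) F x = orbit_sum n F x + orbit_sum m F (act (- n) x)"
proof (induction m rule: int_induct[where k = 0])
  case base
  then show ?case
    by (simp add: orbit_sum_simps(1))
next
  case (step1 i)
  have "act (- i) (act (- n) x) = act (- (i + n)) x"
    by (simp add: act_add[symmetric])
  then show ?case
    using step1 orbit_sum_simps(2)[of "i + n" F x] orbit_sum_simps(2)[of i F "act (- n) x"]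
    by (simp add: algebra_simps)
next
  case (step2 i)
  have "act (- (i - 1)) (act (- n) x) = act (- (i - 1 + n)) x"
    by (simp add: act_add[symmetric])
  then show ?case
    using step2 orbit_sum_simps(2)[of "i - 1 + n" F x] orbit_sum_simps(2)[of "i - 1" F "act (- n) x"]
    by (simp add: algebra_simps)
qed

text \<open>Compares the two ways of splitting a path of length \<open>n + 1\<close>, with the
  single step at its beginning or at its end.\<close>

lemma orbit_sum_shift: "orbit_sum n F (act (- 1) x) - orbit_sum n F x = F (act (- n) x) - F x"
  using orbit_sum_add[of n 1 F x] orbit_sum_simps(2)[of n F x] by (simp add: orbit_sum_simps(3))

text \<open>Each arrow is replaced by its path of unit steps. \<open>Sum_any\<close> ranges over all
  exponents, of which a chain involves only finitely many.\<close>

definition transfer :: "((int \<times> 'x) set list \<Rightarrow> int) \<Rightarrow> 'x \<Rightarrow> int" where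
  "transfer f x = Sum_any (\<lambda>n. orbit_sum n (\<lambda>y. f [arr n y]) x)"

lemma finite_chain_1:
  assumes "f \<in> carrier (chains G 1)"
  shows "finite {n. \<exists>x. f [arr n x] \<noteq> 0}"
  using assms unfolding chains_1
proof induction
  case (base f)
  then consider "f = 0" | n U where "f = indicator (slice n U)"
    by auto
  then show ?case
  proof cases
    case (2 n U)
    have "{n. \<exists>x. f [arr n x] \<noteq> 0} \<subseteq> {n}"
      by (auto simp: 2 slice_def indicator_def)
    then show ?thesis
      using finite_subset by blast
  qed auto
next
  case (diff f g)
  have "{n. \<exists>x. (f - g) [arr n x] \<noteq> 0} \<subseteq> {n. \<exists>x. f [arr n x] \<noteq> 0} \<union> {n. \<exists>x. g [arr n x] \<noteq> 0}"
    by auto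
  then show ?case
    using diff.IH finite_subset by blast
qed

lemma finite_transfer:
  assumes "f \<in> carrier (chains G 1)"
  shows "finite {n. orbit_sum n (\<lambda>y. f [arr n y]) x \<noteq> 0}"
proof (rule finite_subset[OF _ finite_chain_1[OF assms]])
  show "{n. orbit_sum n (\<lambda>y. f [arr n y]) x \<noteq> 0} \<subseteq> {n. \<exists>x. f [arr n x] \<noteq> 0}"
    by (rule subsetI, rule ccontr) (auto simp: orbit_sum_def)
qed

lemma transfer_diff:
  assumes "f \<in> carrier (chains G 1)" "g \<in> carrier (chains G 1)"
  shows "transfer (f - g) = transfer f - transfer g"
proof
  fix x
  have fg: "f - g \<in> carrier (chains G 1)"
    using assms unfolding chains_1 by (rule group_closure.diff)
  have "orbit_sum n (\<lambda>y. (f - g) [arr n y]) x =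
      orbit_sum n (\<lambda>y. f [arr n y]) x - orbit_sum n (\<lambda>y. g [arr n y]) x" for n
    using fun_cong[OF orbit_sum_simps(4)[of n "\<lambda>y. f [arr n y]" "\<lambda>y. g [arr n y]"], of x]
    by (simp add: fun_diff_def)
  then have "transfer f x = Sum_any (\<lambda>n. orbit_sum n (\<lambda>y. (f - g) [arr n y]) x + orbit_sum n (\<lambda>y. g [arr n y]) x)"
    by (simp add: transfer_def)
  also have "\<dots> = transfer (f - g) x + transfer g x"
    unfolding transfer_def by (rule Sum_any.distrib) (rule finite_transfer[OF fg] finite_transfer[OF assms(2)])+
  finally show "transfer (f - g) x = (transfer f - transfer g) x"
    by simp
qed

lemma transfer_lift: "transfer (lift n g) = orbit_sum n g"
proof
  fix x
  have "orbit_sum m (\<lambda>y. lift n g [arr m y]) x = (if m = n then orbit_sum n g x else 0)" for m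
    by (simp add: orbit_sum_def)
  then show "transfer (lift n g) x = orbit_sum n g x"
    unfolding transfer_def by simp
qed

lemma transfer_slice: "transfer (indicator (slice n U)) = orbit_sum n (indicator U)"
  unfolding lift_indicator[symmetric] by (rule transfer_lift)

text \<open>On a generator this is \<open>orbit_sum_shift\<close>. It follows that a chain is a
  cycle exactly if its transfer is invariant under \<open>T\<close>.\<close>

lemma boundary_1_transfer:
  assumes "f \<in> carrier (chains G 1)"
  shows "boundary G 1 f = lift 0 ((transfer f \<circ> act (- 1)) - transfer f)"
  using assms unfolding chains_1
proof induction
  case (base f)
  \<comment> \<open>The induction also starts from zero, which is the indicator of an empty slice;
    thus one case covers the whole base.\<close>
  have zero: "f = 0 \<Longrightarrow> f = indicator (slice 0 {})"
    by (auto simp: slice_def)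
  consider n U where "f = indicator (slice n U)"
    using base zero by auto
  then show ?case
  proof cases
    case (1 n U)
    have "boundary G 1 f = lift 0 ((indicator U \<circ> act (- n)) - indicator U)"
      unfolding 1 boundary_1_slice by (simp only: lift_diff lift_indicator indicator_act_image[symmetric])
    also have "(indicator U \<circ> act (- n)) - indicator U = (transfer f \<circ> act (- 1)) - transfer f"
      unfolding 1 transfer_slice using orbit_sum_shift[of n "indicator U"] by (auto simp: fun_eq_iff)
    finally show ?thesis .
  qed
next
  case (diff f g)
  then have fg: "f \<in> carrier (chains G 1)" "g \<in> carrier (chains G 1)"
    by (simp_all only: chains_1)
  have "((transfer f - transfer g) \<circ> act (- 1)) - (transfer f - transfer g) =
      ((transfer f \<circ> act (- 1)) - transfer f) - ((transfer g \<circ> act (- 1)) - transfer g)"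
    by auto
  then show ?case
    using boundary_1_diff[OF fg] transfer_diff[OF fg] diff.IH by (simp only: lift_diff)
qed

lemma orbit_sum_locally_constant:
  assumes "clopen U"
  shows "orbit_sum n (indicator U) \<in> locally_constant"
proof (induction n rule: int_induct[where k = 0])
  case base
  then show ?case
    by (simp only: orbit_sum_simps(1) locally_constant_zero)
next
  case (step1 i)
  have "orbit_sum (i + 1) (indicator U) = orbit_sum i (indicator U) + indicator (act i ` U)"
    unfolding indicator_act_image by (auto simp: orbit_sum_simps(2))
  then show ?case
    using step1(2) assms by (simp only: locally_constant_add indicator_in_locally_constant clopen_act_image)
next
  case (step2 i)
  have "orbit_sum (i - 1) (indicator U) = orbit_sum i (indicator U) - indicator (act (i - 1) ` U)"
    unfolding indicator_act_image using orbit_sum_simps(2)[of "i - 1" "indicator U"] by auto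
  then show ?case
    using step2(2) assms by (simp only: locally_constant_diff indicator_in_locally_constant clopen_act_image)
qed

lemma transfer_locally_constant:
  assumes "f \<in> carrier (chains G 1)"
  shows "transfer f \<in> locally_constant"
  using assms unfolding chains_1
proof induction
  case (base f)
  have zero: "f = 0 \<Longrightarrow> f = indicator (slice 0 {})"
    by (auto simp: slice_def)
  consider n U where "f = indicator (slice n U)" "clopen U"
    using base zero by auto
  then show ?case
    by cases (simp only: transfer_slice orbit_sum_locally_constant)
next
  case (diff f g)
  then have fg: "f \<in> carrier (chains G 1)" "g \<in> carrier (chains G 1)"
    by (simp_all only: chains_1)
  then show ?case
    using diff.IH by (simp only: transfer_diff[OF fg] locally_constant_diff)
qed

text \<open>Induction on the exponent, upwards and downwards: the relation with \<open>m = 1\<close>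
  splits off the last unit step of the path.\<close>

lemma homologous_to_lift:
  assumes "f \<in> carrier (chains G 1)"
  shows "f - lift 1 (transfer f) \<in> boundary G 2 ` carrier (chains G 2)"
proof -
  let ?B = "boundary G 2 ` carrier (chains G 2)"
  have diff: "f - g \<in> ?B" if "f \<in> ?B" "g \<in> ?B" for f g
    using that unfolding boundary_2_image by (rule group_closure.diff)
  have zero: "0 \<in> ?B"
    unfolding boundary_2_image by (rule zero_in_group_closure)
  have rel: "indicator (slice n U) - indicator (slice (m + n) U) + indicator (slice m (act n ` U)) \<in> ?B"
    if "clopen U" for m n U
    unfolding boundary_2_image using that by (blast intro: group_closure_incl)
  have gen: "indicator (slice n U) - lift 1 (orbit_sum n (indicator U)) \<in> ?B" if U: "clopen U" for n U
  proof (induction n rule: int_induct[where k = 0])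
    case base
    \<comment> \<open>For \<open>m = n = 0\<close> the three terms of the relation reduce to one, so
      the slice of units is itself a boundary.\<close>
    have "act 0 ` U = U"
      by auto
    then have "indicator (slice 0 U) - lift 1 (orbit_sum 0 (indicator U)) =
        indicator (slice 0 U) - indicator (slice (0 + 0) U) + indicator (slice 0 (act 0 ` U))"
      by (simp add: orbit_sum_simps(1) lift_zero)
    then show ?case
      using rel[OF U, of 0 0] by (simp only:)
  next
    case (step1 i)
    have "orbit_sum (i + 1) (indicator U) = orbit_sum i (indicator U) + indicator (act i ` U)"
      unfolding indicator_act_image by (auto simp: orbit_sum_simps(2))
    then have "indicator (slice (i + 1) U) - lift 1 (orbit_sum (i + 1) (indicator U)) =
      (indicator (slice i U) - lift 1 (orbit_sum i (indicator U))) -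
      (indicator (slice i U) - indicator (slice (1 + i) U) + indicator (slice 1 (act i ` U)))"
      by (simp add: lift_add lift_indicator algebra_simps)
    then show ?case
      using diff[OF step1(2) rel[OF U, of i 1]] by (simp only:)
  next
    case (step2 i)
    have "orbit_sum i (indicator U) = orbit_sum (i - 1) (indicator U) + indicator (act (i - 1) ` U)"
      unfolding indicator_act_image using orbit_sum_simps(2)[of "i - 1" "indicator U"] by auto
    then have "indicator (slice (i - 1) U) - lift 1 (orbit_sum (i - 1) (indicator U)) =
      (indicator (slice i U) - lift 1 (orbit_sum i (indicator U))) -
      (0 - (indicator (slice (i - 1) U) - indicator (slice (1 + (i - 1)) U) + indicator (slice 1 (act (i - 1) ` U))))"
      by (simp add: lift_add lift_indicator algebra_simps)
    then show ?case
      using diff[OF step2(2) diff[OF zero rel[OF U, of "i - 1" 1]]] by (simp only:)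
  qed
  show ?thesis
    using assms unfolding chains_1
  proof induction
    case (base f)
    have zero: "f = 0 \<Longrightarrow> f = indicator (slice 0 {})"
      by (auto simp: slice_def)
    consider n U where "f = indicator (slice n U)" "clopen U"
      using base zero by auto
    then show ?case
      by cases (simp only: transfer_slice gen)
  next
    case (diff f g)
    then have fg: "f \<in> carrier (chains G 1)" "g \<in> carrier (chains G 1)"
      by (simp_all only: chains_1)
    have "(f - g) - lift 1 (transfer (f - g)) = (f - lift 1 (transfer f)) - (g - lift 1 (transfer g))"
      by (simp add: transfer_diff[OF fg] lift_diff)
    then show ?case
      using diff.IH \<open>\<And>f g. f \<in> ?B \<Longrightarrow> g \<in> ?B \<Longrightarrow> f - g \<in> ?B\<close> by (simp only:)
  qed
qed

text \<open>The transfer of a cycle is invariant, hence constant, and that constant is the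
  isomorphism. If it is 0, \<open>homologous_to_lift\<close> makes the cycle a boundary; every
  integer is attained by the constant chain of unit steps.\<close>

theorem homology_1_iso:
  assumes inv: "\<And>f. f \<in> locally_constant \<Longrightarrow> f \<circ> T = f \<Longrightarrow> \<exists>c. f = (\<lambda>_. c)"
  shows "groupoid_homology G 1 \<cong> integer_group"
proof (rule groupoid_homology_iso[OF group_integer_group])
  show "boundary G 1 (f - g) = boundary G 1 f - boundary G 1 g"
    if "f \<in> carrier (chains G 1)" "g \<in> carrier (chains G 1)" for f g
    using that by (rule boundary_1_diff)
  \<comment> \<open>Transfers of cycles are constant, so the choice of the point does not affect
    \<open>h\<close> on cycles.\<close>
  define p :: 'x where "p = undefined"
  define h where "h f = transfer f p" for f
  have cyc: "\<exists>c. transfer f = (\<lambda>_. c)" if "f \<in> carrier (cycles G 1)" for f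
  proof (rule inv)
    have f: "f \<in> carrier (chains G 1)" "boundary G 1 f = 0"
      using that by (auto simp: carrier_cycles)
    then have "lift 0 ((transfer f \<circ> act (- 1)) - transfer f) = lift 0 0"
      by (simp only: boundary_1_transfer lift_zero)
    then have "(transfer f \<circ> act (- 1)) - transfer f = 0"
      by (simp only: lift_eq_iff)
    then have *: "transfer f (act (- 1) x) = transfer f x" for x
      by (simp add: fun_eq_iff)
    show "transfer f \<circ> T = transfer f"
      using *[of "T x" for x] act_cancel(2)[of 1] by (auto simp: fun_eq_iff)
    show "transfer f \<in> locally_constant"
      using f(1) by (rule transfer_locally_constant)
  qed
  have h_diff: "h (f - g) = h f - h g" if "f \<in> carrier (chains G 1)" "g \<in> carrier (chains G 1)" for f g
    by (simp add: h_def transfer_diff[OF that])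
  show "h (f + g) = h f \<otimes>\<^bsub>integer_group\<^esub> h g"
    if "f \<in> carrier (cycles G 1)" "g \<in> carrier (cycles G 1)" for f g
  proof -
    have fg: "f \<in> carrier (chains G 1)" "g \<in> carrier (chains G 1)"
      using that by (auto simp: carrier_cycles)
    then have "f + g \<in> carrier (chains G 1)"
      unfolding chains_1 by (rule group_closure_add)
    then show ?thesis
      using h_diff[of "f + g" g] fg by simp
  qed
  show "h ` carrier (cycles G 1) = carrier integer_group"
  proof -
    have "c \<in> h ` carrier (cycles G 1)" for c
    proof
      let ?f = "lift 1 (\<lambda>_. c)"
      have f: "?f \<in> carrier (chains G 1)"
        by (rule lift_in_chains_1[OF locally_constant_const])
      have t: "transfer ?f = (\<lambda>_. c)"
        by (simp only: transfer_lift orbit_sum_simps(3))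
      then show "c = h ?f"
        by (simp add: h_def)
      have "((\<lambda>_. c) \<circ> act (- 1)) - (\<lambda>_. c) = 0"
        by auto
      then have "boundary G 1 ?f = 0"
        by (simp only: boundary_1_transfer[OF f] t lift_zero)
      then show "?f \<in> carrier (cycles G 1)"
        using f by (simp add: carrier_cycles)
    qed
    then show ?thesis
      by auto
  qed
  let ?K = "{f \<in> carrier (cycles G 1). h f = 0}"
  have diff: "f - g \<in> ?K" if "f \<in> ?K" "g \<in> ?K" for f g
  proof -
    have fg: "f \<in> carrier (chains G 1)" "g \<in> carrier (chains G 1)"
      using that by (auto simp: carrier_cycles)
    then have "f - g \<in> carrier (chains G 1)"
      unfolding chains_1 by (rule group_closure.diff)
    then show ?thesis
      using that h_diff[OF fg] boundary_1_diff[OF fg] by (auto simp: carrier_cycles)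
  qed
  have kernelI: "f \<in> ?K" if "f \<in> carrier (chains G 1)" "transfer f = 0" for f
  proof -
    have "boundary G 1 f = lift 0 ((0 \<circ> act (- 1)) - 0)"
      by (simp only: boundary_1_transfer[OF that(1)] that(2))
    also have "((0 \<circ> act (- 1)) - 0) = (0 :: 'x \<Rightarrow> int)"
      by auto
    finally have "boundary G 1 f = 0"
      by (simp only: lift_zero)
    then show ?thesis
      using that by (simp add: carrier_cycles h_def)
  qed
  have "?K = boundary G 2 ` carrier (chains G 2)"
  proof (rule equalityI)
    show "boundary G 2 ` carrier (chains G 2) \<subseteq> ?K"
      unfolding boundary_2_image
    proof (rule group_closure_subsetI[OF _ _ diff])
      have "transfer 0 = 0"
        using transfer_lift[of 0 0] by (simp add: lift_zero orbit_sum_simps(1))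
      then show "0 \<in> ?K"
        by (intro kernelI) (simp_all only: chains_1 zero_in_group_closure)
      have "indicator (slice n U) - indicator (slice (m + n) U) + indicator (slice m (act n ` U)) \<in> ?K"
        if U: "clopen U" for m n U
      proof -
        have slice: "indicator (slice k V) \<in> carrier (chains G 1)" if "clopen V" for k V
          unfolding lift_indicator[symmetric] using that by (intro lift_in_chains_1 indicator_in_locally_constant)
        note E1 = slice[OF U, of n] slice[OF U, of "m + n"] slice[OF clopen_act_image[OF U], of m n]
        have z: "0 \<in> carrier (chains G 1)"
          unfolding chains_1 by (rule zero_in_group_closure)
        have d: "f - g \<in> carrier (chains G 1)" if "f \<in> carrier (chains G 1)" "g \<in> carrier (chains G 1)" for f g
          using that unfolding chains_1 by (rule group_closure.diff)
        \<comment> \<open>The sum is written with nested differences because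
          \<open>transfer_diff\<close> computes the transfer of a difference.\<close>
        let ?f = "indicator (slice n U) - indicator (slice (m + n) U) - (0 - indicator (slice m (act n ` U)))"
        have "transfer ?f = orbit_sum n (indicator U) - orbit_sum (m + n) (indicator U)
            - (0 - orbit_sum m (indicator (act n ` U)))"
          using E1 z d by (simp only: transfer_diff transfer_slice \<open>transfer 0 = 0\<close>)
        also have "\<dots> = 0"
        proof
          fix x
          have "orbit_sum m (indicator (act n ` U)) x = orbit_sum m (indicator U) (act (- n) x)"
            unfolding indicator_act_image by (simp add: orbit_sum_def act_add[symmetric] add.commute)
          then show "(orbit_sum n (indicator U) - orbit_sum (m + n) (indicator U)
            - (0 - orbit_sum m (indicator (act n ` U)))) x = 0 x"
            by (simp add: orbit_sum_add)
        qed
        finally have "?f \<in> ?K"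
          by (intro kernelI d E1 z)
        then show ?thesis
          by (simp only: diff_0 diff_minus_eq_add)
      qed
      then show "{indicator (slice n U) - indicator (slice (m + n) U) + indicator (slice m (act n ` U)) | m n U. clopen U} \<subseteq> ?K"
        by blast
    qed
    show "?K \<subseteq> boundary G 2 ` carrier (chains G 2)"
    proof
      fix f assume f: "f \<in> ?K"
      then obtain c where c: "transfer f = (\<lambda>_. c)"
        using cyc by blast
      then have "transfer f = 0"
        using f by (auto simp: h_def)
      moreover have "f \<in> carrier (chains G 1)"
        using f by (simp add: carrier_cycles)
      ultimately show "f \<in> boundary G 2 ` carrier (chains G 2)"
        using homologous_to_lift[of f] by (simp only: lift_zero diff_0_right)
    qed
  qed
  then show "{f \<in> carrier (cycles G 1). h f = \<one>\<^bsub>integer_group\<^esub>} =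
      boundary G (Suc 1) ` carrier (chains G (Suc 1))"
    by (simp add: numeral_2_eq_2)
qed

end


section \<open>The split interval and the golden mean rotation\<close>

text \<open>Isolating the root and squaring gives
  \<open>(2 * a + b)\<^sup>2 = 5 * b\<^sup>2\<close>. Unless \<open>b = 0\<close>, the prime 5 has
  even multiplicity on the left and odd multiplicity on the right.\<close>

lemma golden_int_lincomb_eq_0:
  fixes a b :: int
  assumes "of_int a + of_int b * golden = 0"
  shows "a = 0 \<and> b = 0"
proof -
  have "real_of_int (2 * a + b) = - of_int b * sqrt 5"
    using assms by (simp add: golden_def field_simps)
  then have "(real_of_int (2 * a + b))\<^sup>2 = 5 * (real_of_int b)\<^sup>2"
    by (simp add: power_mult_distrib)
  then have "real_of_int ((2 * a + b)\<^sup>2) = real_of_int (5 * b\<^sup>2)"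
    by simp
  then have *: "(2 * a + b)\<^sup>2 = 5 * b\<^sup>2"
    by (simp only: of_int_eq_iff)
  have "b = 0"
  proof (rule ccontr)
    assume b: "b \<noteq> 0"
    then have ab: "2 * a + b \<noteq> 0"
      using * by auto
    have 5: "prime_elem (5 :: int)"
      by (rule prime_imp_prime_elem) simp
    have "multiplicity 5 ((2 * a + b)\<^sup>2) = multiplicity 5 (5 * b\<^sup>2)"
      by (simp only: *)
    then have "2 * multiplicity 5 (2 * a + b) = 1 + 2 * multiplicity 5 b"
      using 5 b ab by (simp add: prime_elem_multiplicity_power_distrib prime_elem_multiplicity_mult_distrib)
    then show False
      by presburger
  qed
  then show ?thesis
    using * by simp
qed

lemma golden_irrational: "golden \<notin> \<rat>"
proof
  assume "golden \<in> \<rat>"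
  then obtain m n :: int where "n \<noteq> 0" "golden = of_int m / of_int n"
    by (metis Rats_cases' less_irrefl)
  then have "of_int (- m) + of_int n * golden = 0"
    by (simp add: field_simps)
  then show False
    using golden_int_lincomb_eq_0 \<open>n \<noteq> 0\<close> by blast
qed

text \<open>Kronecker density of the multiples of \<open>golden\<close> modulo 1, applied to the
  midpoint of the interval with half its length as tolerance.\<close>

lemma golden_ints_dense:
  assumes "a < b"
  obtains y where "y \<in> golden_ints" "a < y" "y < b"
proof -
  obtain h k where "\<bar>of_int k * golden - of_int h - (a + b) / 2\<bar> < (b - a) / 2"
    by (rule sequence_of_fractional_parts_is_dense[OF golden_irrational, of "(b - a) / 2" "(a + b) / 2"])
      (use assms in auto)
  moreover have "of_int k * golden - of_int h \<in> golden_ints"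
    unfolding golden_ints_def by (intro CollectI exI[of _ "- h"] exI[of _ k]) simp
  ultimately show thesis
    by (intro that[of "of_int k * golden - of_int h"]) (auto simp: abs_if field_simps split: if_splits)
qed

section \<open>Order and compactness of the split interval\<close>

definition pos :: "split_interval \<Rightarrow> real" where
  "pos p = fst (Rep_split_interval p)"

definition side :: "split_interval \<Rightarrow> int" where
  "side p = snd (Rep_split_interval p)"

lemma Rep_eq: "Rep_split_interval p = (pos p, side p)"
  by (simp add: pos_def side_def)

lemma split_interval_eqI: "pos p = pos q \<Longrightarrow> side p = side q \<Longrightarrow> p = q"
  by (metis Rep_eq Rep_split_interval_inject)

lemma pos_bounds: "0 \<le> pos p" "pos p \<le> 1"
  and side_eq: "pos p = 0 \<Longrightarrow> side p = 1" "pos p = 1 \<Longrightarrow> side p = - 1"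
  and side_cases: "side p = 0 \<and> pos p \<notin> golden_ints \<or> (side p = - 1 \<or> side p = 1) \<and> pos p \<in> golden_ints"
  using Rep_split_interval[of p] golden_ints_shifts(6,7) by (auto simp: Rep_eq split: if_splits)

lemma side_le_1: "side p \<le> 1"
  using side_cases[of p] by auto

lemma ex_point:
  assumes "0 \<le> x" "x \<le> 1"
    "if x = 0 then t = 1 else if x = 1 then t = -1 else if x \<in> golden_ints then t = -1 \<or> t = 1 else t = 0"
  obtains p where "pos p = x" "side p = t"
proof -
  have "Rep_split_interval (Abs_split_interval (x, t)) = (x, t)"
    using assms by (intro Abs_split_interval_inverse) auto
  then show thesis
    by (intro that[of "Abs_split_interval (x, t)"]) (auto simp: pos_def side_def)
qed

lemma less_split_iff: "p < q \<longleftrightarrow> pos p < pos q \<or> pos p = pos q \<and> side p < side q"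
  by (simp add: less_split_interval_def Rep_eq)

lemma le_split_iff: "p \<le> q \<longleftrightarrow> pos p < pos q \<or> pos p = pos q \<and> side p \<le> side q"
  by (simp add: less_eq_split_interval_iff Rep_eq)

text \<open>The real supremum of the positions determines the point up to its side. If it is
  attained in \<open>S\<close>, the greatest side occurring there is taken, otherwise the lowest
  point at that position.\<close>

lemma split_interval_supremum:
  fixes S :: "split_interval set"
  assumes "S \<noteq> {}"
  shows "\<exists>m. (\<forall>s\<in>S. s \<le> m) \<and> (\<forall>l<m. \<exists>s\<in>S. l < s)"
proof -
  define x where "x = Sup (pos ` S)"
  have bdd: "bdd_above (pos ` S)"
    using pos_bounds(2) by (intro bdd_aboveI2[of _ _ 1])
  have le: "pos s \<le> x" if "s \<in> S" for s
    using cSup_upper[OF _ bdd] that by (simp add: x_def)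
  have x01: "0 \<le> x" "x \<le> 1"
  proof -
    obtain s where "s \<in> S"
      using assms by auto
    then show "0 \<le> x"
      using le[of s] pos_bounds(1)[of s] by simp
    show "x \<le> 1"
      unfolding x_def using assms pos_bounds(2) by (intro cSup_least) auto
  qed
  show ?thesis
  proof (cases "\<exists>s\<in>S. pos s = x")
    case True
    then obtain s0 where s0: "s0 \<in> S" "pos s0 = x"
      by auto
    obtain m where m: "m \<in> S" "pos m = x" "\<And>s. s \<in> S \<Longrightarrow> pos s = x \<Longrightarrow> side s \<le> side m"
    proof (cases "\<exists>s\<in>S. pos s = x \<and> side s = 1")
      case True
      then obtain m where "m \<in> S" "pos m = x" "side m = 1"
        by auto
      then show thesis
        using side_le_1 by (intro that[of m]) auto
    next
      case False
      have "side s \<le> side s0" if "s \<in> S" "pos s = x" for s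
        using side_cases[of s] side_cases[of s0] False s0 that by auto
      then show thesis
        using s0 by (intro that[of s0]) auto
    qed
    show ?thesis
    proof (intro exI[of _ m] conjI ballI allI impI)
      show "s \<le> m" if "s \<in> S" for s
        using m le[OF that] that by (auto simp: le_split_iff)
      show "\<exists>s\<in>S. l < s" if "l < m" for l
        using m(1) that by auto
    qed
  next
    case False
    then have lt: "pos s < x" if "s \<in> S" for s
      using le[OF that] that by (auto simp: order_less_le)
    then have "0 < x"
      using assms pos_bounds(1) by (metis all_not_in_conv order_le_less_trans)
    \<comment> \<open>With this side nothing at position \<open>x\<close> lies below
      \<open>m\<close>, so every smaller point has a strictly smaller position.\<close>
    obtain m where m: "pos m = x" "side m = (if x \<in> golden_ints then - 1 else 0)"
      by (rule ex_point[of x "if x \<in> golden_ints then - 1 else 0"])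
        (use x01 \<open>0 < x\<close> golden_ints_shifts(7) in auto)
    show ?thesis
    proof (intro exI[of _ m] conjI ballI allI impI)
      show "s \<le> m" if "s \<in> S" for s
        using lt[OF that] by (simp add: le_split_iff m)
      show "\<exists>s\<in>S. l < s" if "l < m" for l
      proof -
        have "pos l < x"
          using that side_cases[of l] by (auto simp: less_split_iff m split: if_splits)
        then obtain s where "s \<in> S" "pos l < pos s"
          using less_cSup_iff[OF _ bdd, of "pos l"] assms by (auto simp: x_def)
        then show ?thesis
          by (auto simp: less_split_iff)
      qed
    qed
  qed
qed

text \<open>The Heine-Borel argument: \<open>m\<close> is the supremum of the points whose lower ray
  has a finite subcover. A member of the cover around \<open>m\<close> puts \<open>m\<close> into
  \<open>S\<close> and excludes points above it.\<close>

lemma compact_split_interval: "compact (UNIV :: split_interval set)"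
proof (rule compactI)
  fix C :: "split_interval set set"
  assume op: "\<forall>U\<in>C. open U" and cover: "UNIV \<subseteq> \<Union>C"
  define S where "S = {p. \<exists>C'\<subseteq>C. finite C' \<and> {..p} \<subseteq> \<Union>C'}"
  obtain b where "pos b = 0" "side b = 1"
    by (rule ex_point[of 0 1]) auto
  then have b: "b \<le> p" for p
    using pos_bounds[of p] side_eq(1)[of p] by (auto simp: le_split_iff order_le_less)
  obtain U0 where "b \<in> U0" "U0 \<in> C"
    using cover by auto
  moreover have "x \<le> b \<longleftrightarrow> x = b" for x
    using b[of x] by auto
  then have "{..b} = {b}"
    by auto
  ultimately have "b \<in> S"
    unfolding S_def by (intro CollectI exI[of _ "{U0}"] conjI) simp_all
  then have "S \<noteq> {}"
    by auto
  then obtain m where m: "\<forall>s\<in>S. s \<le> m" "\<forall>l<m. \<exists>s\<in>S. l < s"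
    using split_interval_supremum[of S] by blast
  obtain U where U: "m \<in> U" "U \<in> C"
    using cover by auto
  then have "open U"
    using op by auto
  have "m \<in> S"
  proof (cases "m = b")
    case False
    then have "b < m"
      using b[of m] by auto
    then obtain l where l: "l < m" "{l<..m} \<subseteq> U"
      using open_left[OF \<open>open U\<close> U(1)] by blast
    then obtain s where s: "s \<in> S" "l < s"
      using m(2) by blast
    then obtain C' where "C' \<subseteq> C" "finite C'" "{..s} \<subseteq> \<Union>C'"
      by (auto simp: S_def)
    moreover have "{..m} \<subseteq> {..s} \<union> {l<..m}"
      using s by auto
    ultimately have "insert U C' \<subseteq> C" "finite (insert U C')" "{..m} \<subseteq> \<Union>(insert U C')"
      using U l(2) by (blast, simp, blast)
    then show ?thesis
      unfolding S_def by blast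
  qed (use \<open>b \<in> S\<close> in simp)
  then obtain C' where C': "C' \<subseteq> C" "finite C'" "{..m} \<subseteq> \<Union>C'"
    by (auto simp: S_def)
  have "p \<le> m" for p
  proof (rule ccontr)
    assume "\<not> p \<le> m"
    then have "m < p"
      by simp
    then obtain u where u: "m < u" "{m..<u} \<subseteq> U"
      using open_right[OF \<open>open U\<close> U(1)] by blast
    \<comment> \<open>The order has jumps, so \<open>{m..<u}\<close> may be just \<open>{m}\<close>;
      only a separate set covering \<open>u\<close> brings a point above \<open>m\<close> into
      \<open>S\<close>.\<close>
    obtain V where V: "u \<in> V" "V \<in> C"
      using cover by auto
    have "{..u} \<subseteq> {..m} \<union> {m..<u} \<union> {u}"
      by auto
    then have "{..u} \<subseteq> \<Union>(insert V (insert U C'))"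
      by (rule order_trans) (use C'(3) u(2) V(1) in \<open>simp add: le_supI1 le_supI2\<close>)
    moreover have "insert V (insert U C') \<subseteq> C" "finite (insert V (insert U C'))"
      using C' U V by simp_all
    ultimately have "u \<in> S"
      unfolding S_def by blast
    then show False
      using m(1) u(1) by auto
  qed
  then have "UNIV \<subseteq> \<Union>C'"
    using C'(3) by blast
  then show "\<exists>C'\<subseteq>C. finite C' \<and> UNIV \<subseteq> \<Union>C'"
    using C'(1,2) by (intro exI[of _ C'] conjI)
qed

section \<open>Initial segments as clopen sets\<close>

text \<open>These are the positions with a left copy: 0 has none, and 1 has only this one, whose
  segment is the whole space.\<close>

definition cuts :: "real set" where
  "cuts = {y \<in> golden_ints. 0 < y \<and> y \<le> 1}"

abbreviation initial_segment :: "real \<Rightarrow> split_interval set" where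
  "initial_segment y \<equiv> {..left_limit y}"

lemma initial_segment_iff:
  assumes "y \<in> cuts"
  shows "p \<in> initial_segment y \<longleftrightarrow> pos p < y \<or> pos p = y \<and> side p = - 1"
proof -
  have "Rep_split_interval (left_limit y) = (y, - 1)"
    using assms by (intro Rep_left_limit) (auto simp: cuts_def)
  then show ?thesis
    using side_cases[of p] by (auto simp: less_eq_split_interval_iff Rep_eq)
qed

lemma initial_segment_1: "initial_segment 1 = UNIV"
proof -
  have "p \<in> initial_segment 1" for p
    using pos_bounds(2)[of p] side_eq(2)[of p]
    by (subst initial_segment_iff) (auto simp: cuts_def golden_ints_shifts(7))
  then show ?thesis
    by blast
qed

text \<open>No point lies between the two copies of \<open>y\<close>, so the closed ray up to the
  left copy is the open ray below the right copy.\<close>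

lemma clopen_initial_segment:
  assumes "y \<in> cuts"
  shows "open (initial_segment y)" "closed (initial_segment y)"
proof -
  show "open (initial_segment y)"
  proof (cases "y = 1")
    case False
    then have y: "y \<in> golden_ints" "0 \<le> y" "y < 1"
      using assms by (auto simp: cuts_def)
    have "pos (right_limit y) = y" "side (right_limit y) = 1"
      using Rep_right_limit[OF y] by (auto simp: pos_def side_def)
    then have "p \<in> initial_segment y \<longleftrightarrow> p < right_limit y" for p
      unfolding initial_segment_iff[OF assms] less_split_iff
      using side_cases[of p] y by auto
    then have "initial_segment y = {..<right_limit y}"
      by blast
    then show ?thesis
      by simp
  qed (simp add: initial_segment_1)
qed simp

lemma clopen_interval_eq:
  assumes "x \<in> golden_ints" "0 \<le> x" "x < y" "y \<in> cuts"
  shows "clopen_interval x y = (if x = 0 then initial_segment y else initial_segment y - initial_segment x)"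
proof (rule Set.set_eqI)
  fix p
  have iff: "p \<in> clopen_interval x y \<longleftrightarrow>
      (x < pos p \<or> x = pos p \<and> side p = 1) \<and> (pos p < y \<or> pos p = y \<and> side p = - 1)"
    using assms by (intro clopen_interval_iff[OF Rep_eq]) (auto simp: cuts_def)
  show "p \<in> clopen_interval x y \<longleftrightarrow>
      p \<in> (if x = 0 then initial_segment y else initial_segment y - initial_segment x)"
  proof (cases "x = 0")
    case True
    then show ?thesis
      unfolding iff if_P[OF True] initial_segment_iff[OF assms(4)]
      using pos_bounds(1)[of p] side_eq(1)[of p] by auto
  next
    case False
    then have "x \<in> cuts"
      using assms by (auto simp: cuts_def)
    then show ?thesis
      unfolding iff if_not_P[OF False] Diff_iff initial_segment_iff[OF assms(4)]
        initial_segment_iff[OF \<open>x \<in> cuts\<close>]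
      using assms(1) side_cases[of p] by auto
  qed
qed

text \<open>Induction over the generation of the topology by open rays. Density of
  \<open>golden_ints\<close> provides an end point between \<open>p\<close> and the end of a ray
  whenever their positions differ.\<close>

lemma split_interval_basis:
  assumes "open U" "p \<in> U"
  obtains x y where "x \<in> golden_ints" "0 \<le> x" "x < y" "y \<in> cuts" "p \<in> clopen_interval x y"
    "clopen_interval x y \<subseteq> U"
proof -
  let ?P = "\<lambda>U p. \<exists>x y. x \<in> golden_ints \<and> 0 \<le> x \<and> x < y \<and> y \<in> cuts \<and> p \<in> clopen_interval x y \<and>
    clopen_interval x y \<subseteq> U"
  have iff: "q \<in> clopen_interval x y \<longleftrightarrow>
      (x < pos q \<or> x = pos q \<and> side q = 1) \<and> (pos q < y \<or> pos q = y \<and> side q = - 1)"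
    if "x \<in> golden_ints" "0 \<le> x" "x < y" "y \<in> cuts" for q x y
    using that by (intro clopen_interval_iff[OF Rep_eq]) (auto simp: cuts_def)
  have cut1: "1 \<in> cuts" and g0: "0 \<in> golden_ints"
    using golden_ints_shifts(6,7) by (auto simp: cuts_def)
  have all: "q \<in> clopen_interval 0 1" for q
    using pos_bounds[of q] side_eq[of q] cut1 g0 by (subst iff) auto
  have "generate_topology (range lessThan \<union> range greaterThan) U"
    using assms(1) by (simp add: open_split_interval_def)
  then have "\<forall>p\<in>U. ?P U p"
  proof induction
    case UNIV
    then show ?case
      using all cut1 g0 by (intro ballI exI[of _ 0] exI[of _ 1]) auto
  next
    case (Int U V)
    show ?case
    proof
      fix p assume "p \<in> U \<inter> V"
      then have PU: "?P U p" and PV: "?P V p"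
        using Int.IH by simp_all
      obtain x y where xy: "x \<in> golden_ints" "0 \<le> x" "x < y" "y \<in> cuts" "p \<in> clopen_interval x y"
          "clopen_interval x y \<subseteq> U"
        using PU by (elim exE conjE)
      obtain x' y' where xy': "x' \<in> golden_ints" "0 \<le> x'" "x' < y'" "y' \<in> cuts"
          "p \<in> clopen_interval x' y'" "clopen_interval x' y' \<subseteq> V"
        using PV by (elim exE conjE)
      have lt: "max x x' < min y y'"
        using xy(1-5) xy'(1-5) by (auto simp: iff)
      have m: "max x x' \<in> golden_ints" "0 \<le> max x x'" "min y y' \<in> cuts"
        using xy xy' by (auto simp: max_def min_def)
      have "q \<in> clopen_interval (max x x') (min y y') \<longleftrightarrow> q \<in> clopen_interval x y \<and> q \<in> clopen_interval x' y'" for q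
        unfolding iff[OF m(1,2) lt m(3)] iff[OF xy(1-4)] iff[OF xy'(1-4)] by (auto simp: max_def min_def)
      then show "?P (U \<inter> V) p"
        using m lt xy(5,6) xy'(5,6) by (intro exI[of _ "max x x'"] exI[of _ "min y y'"]) auto
    qed
  next
    case (UN K)
    show ?case
    proof
      fix p assume "p \<in> \<Union>K"
      then obtain k where k: "p \<in> k" "k \<in> K"
        by blast
      then have "?P k p"
        using UN.IH by blast
      then show "?P (\<Union>K) p"
        using k by (elim exE conjE) (intro exI conjI; blast)
    qed
  next
    case (Basis s)
    then consider a where "s = {..<a}" | a where "s = {a<..}"
      by auto
    then show ?case
    proof cases
      case (1 a)
      show ?thesis
      proof
        fix p assume "p \<in> s"
        then have pa: "pos p < pos a \<or> pos p = pos a \<and> side p < side a"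
          by (simp add: 1 less_split_iff)
        obtain y where y: "y \<in> cuts" "p \<in> clopen_interval 0 y" "\<And>q. q \<in> clopen_interval 0 y \<Longrightarrow> q < a"
        proof (cases "pos p < pos a")
          case True
          then obtain y where "y \<in> golden_ints" "pos p < y" "y < pos a"
            by (rule golden_ints_dense)
          moreover from this have "y \<in> cuts" "0 < y"
            using pos_bounds[of p] pos_bounds[of a] by (auto simp: cuts_def)
          ultimately show thesis
            using side_eq(1)[of p] pos_bounds[of p] g0
            by (intro that[of y]) (auto simp: iff less_split_iff)
        next
          \<comment> \<open>Here \<open>p\<close> and \<open>a\<close> are the left and right copy
            of one position, which itself serves as the end of the interval.\<close>
          case False
          then have "pos p = pos a" "side p = - 1" "side a = 1" "pos p \<in> golden_ints"
            using pa side_cases[of p] side_cases[of a] by auto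
          moreover from this have "pos p \<noteq> 0"
            using side_eq(1)[of p] by auto
          ultimately have "pos p \<in> cuts" "0 < pos p"
            using pos_bounds[of p] by (auto simp: cuts_def)
          then show thesis
            using \<open>pos p = pos a\<close> \<open>side p = - 1\<close> \<open>side a = 1\<close> g0
            by (intro that[of "pos p"]) (auto simp: iff less_split_iff)
        qed
        then show "?P s p"
          using g0 by (intro exI[of _ 0] exI[of _ y]) (auto simp: 1 cuts_def)
      qed
    next
      case (2 a)
      show ?thesis
      proof
        fix p assume "p \<in> s"
        then have pa: "pos a < pos p \<or> pos a = pos p \<and> side a < side p"
          by (simp add: 2 less_split_iff)
        obtain x where x: "x \<in> golden_ints" "0 \<le> x" "x < 1" "p \<in> clopen_interval x 1"
          "\<And>q. q \<in> clopen_interval x 1 \<Longrightarrow> a < q"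
        proof (cases "pos a < pos p")
          case True
          then obtain x where "x \<in> golden_ints" "pos a < x" "x < pos p"
            by (rule golden_ints_dense)
          moreover from this have "0 \<le> x" "x < 1"
            using pos_bounds[of p] pos_bounds[of a] by auto
          ultimately show thesis
            using side_eq(2)[of p] pos_bounds[of p] cut1
            by (intro that[of x]) (auto simp: iff less_split_iff)
        next
          case False
          then have "pos p = pos a" "side p = 1" "side a = - 1" "pos p \<in> golden_ints"
            using pa side_cases[of p] side_cases[of a] by auto
          moreover from this have "pos p \<noteq> 1"
            using side_eq(2)[of p] by auto
          ultimately have "pos p \<in> golden_ints" "0 \<le> pos p" "pos p < 1"
            using pos_bounds[of p] by auto
          then show thesis
            using \<open>pos p = pos a\<close> \<open>side p = 1\<close> \<open>side a = - 1\<close> cut1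
            by (intro that[of "pos p"]) (auto simp: iff less_split_iff)
        qed
        then show "?P s p"
          using cut1 by (intro exI[of _ x] exI[of _ 1]) (auto simp: 2)
      qed
    qed
  qed
  then show thesis
    using assms(2) that by blast
qed

text \<open>Since \<open>golden\<^sup>2 = golden + 1\<close>, \<open>2 - golden\<close> is the point \<open>inverse golden ^ 2\<close> of \<open>golden_rotation\<close>.\<close>

definition wrap :: "split_interval set" where
  "wrap = - initial_segment (2 - golden)"

lemma cuts_golden: "2 - golden \<in> cuts" "1 \<in> cuts"
  using golden_facts(1,4) golden_ints_shifts(4,7) by (auto simp: cuts_def)

lemma wrap_iff: "p \<in> wrap \<longleftrightarrow> \<not> (pos p < 2 - golden \<or> pos p = 2 - golden \<and> side p = - 1)"
  unfolding wrap_def Compl_iff initial_segment_iff[OF cuts_golden(1)] ..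

section \<open>The rotation in coordinates\<close>

lemma pos_golden_rotation:
  "pos (golden_rotation p) = pos p + golden - 1 - indicator wrap p"
  and side_golden_rotation: "side (golden_rotation p) = side p"
proof -
  have "(pos (golden_rotation p), side (golden_rotation p)) =
    (if pos p < 2 - golden \<or> pos p = 2 - golden \<and> side p = - 1 then pos p + golden - 1
     else pos p + golden - 2, side p)"
    using Rep_golden_rotation[OF Rep_eq, of p] by (simp only: Rep_eq)
  then show "pos (golden_rotation p) = pos p + golden - 1 - indicator wrap p"
    "side (golden_rotation p) = side p"
    by (auto simp: wrap_iff indicator_def)
qed

text \<open>Points with equal images have equal sides and positions differing by an integer.
  Distinct positions would have to be 0 and 1, whose sides are opposite.\<close>

lemma bij_golden_rotation: "bij golden_rotation"
proof (rule bijI)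
  show "inj golden_rotation"
  proof (rule injI)
    fix p q assume "golden_rotation p = golden_rotation q"
    then have *: "side p = side q" "pos p - indicator wrap p = pos q - indicator wrap q"
      using side_golden_rotation[of p] side_golden_rotation[of q]
        pos_golden_rotation[of p] pos_golden_rotation[of q] by auto
    have "pos p = pos q"
    proof (rule ccontr)
      assume "pos p \<noteq> pos q"
      then have "pos p = pos q + 1 \<or> pos q = pos p + 1"
        using *(2) by (cases "p \<in> wrap"; cases "q \<in> wrap") auto
      then have "pos p = 1 \<and> pos q = 0 \<or> pos p = 0 \<and> pos q = 1"
        using pos_bounds[of p] pos_bounds[of q] by auto
      then show False
        using side_eq[of p] side_eq[of q] *(1) by auto
    qed
    then show "p = q"
      using *(1) by (rule split_interval_eqI)
  qed
  have "q \<in> range golden_rotation" for q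
  proof -
    have g: "golden - 1 \<in> golden_ints" "0 \<in> golden_ints" "1 \<in> golden_ints" "0 < golden - 1" "golden - 1 < 1"
      using golden_ints_shifts(5-7) golden_facts(1,4) by auto
    have "q \<in> clopen_interval 0 (golden - 1) \<or> q \<in> clopen_interval (golden - 1) 1"
    proof (cases "pos q < golden - 1 \<or> pos q = golden - 1 \<and> side q = - 1")
      case True
      have "q \<in> clopen_interval 0 (golden - 1)"
        using g True pos_bounds(1)[of q] side_eq(1)[of q]
        by (subst clopen_interval_iff[OF Rep_eq g(2,1)]) auto
      then show ?thesis ..
    next
      case False
      have "q \<in> clopen_interval (golden - 1) 1"
        using g False pos_bounds(2)[of q] side_eq(2)[of q] side_cases[of q]
        by (subst clopen_interval_iff[OF Rep_eq g(1,3)]) auto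
      then show ?thesis ..
    qed
    then show ?thesis
      using golden_rotation_image unfolding golden_facts(2) by blast
  qed
  then show "surj golden_rotation"
    by blast
qed

text \<open>For \<open>c = 0\<close> the preimage is the disjoint union of the segment at
  \<open>y'\<close> and \<open>wrap\<close>. For \<open>c = 1\<close> it is their intersection, and
  their union is everything. Inclusion-exclusion yields the formula in both cases.\<close>

lemma initial_segment_golden_rotation:
  assumes "y \<in> cuts" "y' \<in> cuts" "c = 0 \<or> c = 1" "y = y' + golden - 1 - of_int c"
  shows "indicator (initial_segment y) (golden_rotation p) =
    indicator (initial_segment y') p + indicator wrap p - c"
proof -
  have *: "golden_rotation p \<in> initial_segment y \<longleftrightarrow>
      pos p + golden - 1 - indicator wrap p < y \<or> pos p + golden - 1 - indicator wrap p = y \<and> side p = - 1"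
    unfolding initial_segment_iff[OF assms(1)] pos_golden_rotation side_golden_rotation ..
  have y: "0 < y" "y \<le> 1" "0 < y'" "y' \<le> 1"
    using assms(1,2) by (auto simp: cuts_def)
  have 1: "golden_rotation p \<in> initial_segment y \<longleftrightarrow> p \<in> wrap \<or> p \<in> initial_segment y'" if c: "c = 0"
  proof (cases "p \<in> wrap")
    case True
    then show ?thesis
      using * pos_bounds[of p] side_eq[of p] y assms(4) c golden_facts(1,4) by auto
  next
    case False
    then show ?thesis
      unfolding * initial_segment_iff[OF assms(2)] using assms(4) c by auto
  qed
  have 2: "p \<in> wrap \<Longrightarrow> p \<notin> initial_segment y'" if c: "c = 0"
    using that y assms(4) golden_facts unfolding wrap_iff initial_segment_iff[OF assms(2)] by auto
  have 3: "golden_rotation p \<in> initial_segment y \<longleftrightarrow> p \<in> wrap \<and> p \<in> initial_segment y'" if c: "c = 1"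
  proof (cases "p \<in> wrap")
    case True
    then show ?thesis
      unfolding * initial_segment_iff[OF assms(2)] using assms(4) c by auto
  next
    case False
    then show ?thesis
      using * pos_bounds[of p] side_eq[of p] y assms(4) c golden_facts(1,4) by auto
  qed
  have 4: "p \<notin> wrap \<Longrightarrow> p \<in> initial_segment y'" if c: "c = 1"
    using that y assms(4) golden_facts unfolding wrap_iff initial_segment_iff[OF assms(2)] by auto
  from assms(3) show ?thesis
    using 1 2 3 4 by (auto simp: indicator_def simp del: atMost_iff)
qed

lemma cuts_shift:
  assumes "y \<in> golden_ints"
  shows "y + of_int a + of_int b * golden \<in> golden_ints"
  using assms golden_ints_shift[of y a b] by (simp add: add.assoc)

text \<open>The inverse rotation on the half-open interval (0, 1], with \<open>c\<close> chosen so
  that \<open>y'\<close> does not leave it.\<close>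

lemma cuts_predecessor:
  assumes "y \<in> cuts"
  obtains c :: int and y' where "c = 0 \<or> c = 1" "y' \<in> cuts" "y = y' + golden - 1 - of_int c"
proof (cases "y \<le> golden - 1")
  case True
  have "y - golden + 2 \<in> cuts"
    using assms True cuts_shift[of y 2 "- 1"] golden_facts by (auto simp: cuts_def algebra_simps)
  then show thesis
    by (intro that[of 1 "y - golden + 2"]) auto
next
  case False
  have "y - golden + 1 \<in> cuts"
    using assms False cuts_shift[of y 1 "- 1"] golden_facts by (auto simp: cuts_def algebra_simps)
  then show thesis
    by (intro that[of 0 "y - golden + 1"]) auto
qed

lemma cuts_successor:
  assumes "y' \<in> cuts"
  obtains c :: int and y where "c = 0 \<or> c = 1" "y \<in> cuts" "y = y' + golden - 1 - of_int c"
proof (cases "y' \<le> 2 - golden")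
  case True
  have "y' + golden - 1 \<in> cuts"
    using assms True cuts_shift[of y' "- 1" 1] golden_facts by (auto simp: cuts_def algebra_simps)
  then show thesis
    by (intro that[of 0 "y' + golden - 1"]) auto
next
  case False
  have "y' + golden - 2 \<in> cuts"
    using assms False cuts_shift[of y' "- 2" 1] golden_facts by (auto simp: cuts_def algebra_simps)
  then show thesis
    by (intro that[of 1 "y' + golden - 2"]) auto
qed

lemma clopen_wrap: "open wrap" "closed wrap"
  unfolding wrap_def using clopen_initial_segment[OF cuts_golden(1)] by (auto simp: open_closed)

lemma clopen_vimage_golden_rotation:
  assumes "y \<in> cuts"
  shows "open (golden_rotation -` initial_segment y)" "closed (golden_rotation -` initial_segment y)"
proof -
  obtain c y' where c: "c = 0 \<or> c = 1" "y' \<in> cuts" "y = y' + golden - 1 - of_int c"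
    using cuts_predecessor[OF assms] .
  have "golden_rotation p \<in> initial_segment y \<longleftrightarrow>
      p \<in> (if c = 0 then initial_segment y' \<union> wrap else initial_segment y' \<inter> wrap)" for p
    using initial_segment_golden_rotation[OF assms c(2,1,3), of p] c(1)
    by (cases "p \<in> initial_segment y'"; cases "p \<in> wrap"; cases "golden_rotation p \<in> initial_segment y")
      (auto simp del: atMost_iff)
  then have "golden_rotation -` initial_segment y =
      (if c = 0 then initial_segment y' \<union> wrap else initial_segment y' \<inter> wrap)"
    by (simp add: vimage_def del: atMost_iff)
  then show "open (golden_rotation -` initial_segment y)" "closed (golden_rotation -` initial_segment y)"
    using clopen_initial_segment[OF c(2)] clopen_wrap
    by (simp_all add: open_Un closed_Un open_Int closed_Int)
qed

text \<open>The jump at \<open>2 - golden\<close> does no harm because \<open>wrap\<close> is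
  clopen. Basic intervals are segments or differences of segments, whose preimages are
  clopen.\<close>

lemma continuous_golden_rotation: "continuous_on UNIV golden_rotation"
  unfolding continuous_on_open_vimage[OF open_UNIV]
proof (intro allI impI)
  fix B :: "split_interval set" assume "open B"
  have "\<exists>T. open T \<and> p \<in> T \<and> T \<subseteq> golden_rotation -` B" if pB: "golden_rotation p \<in> B" for p
  proof -
    obtain x y where xy: "x \<in> golden_ints" "0 \<le> x" "x < y" "y \<in> cuts"
        "golden_rotation p \<in> clopen_interval x y" "clopen_interval x y \<subseteq> B"
      using split_interval_basis[OF \<open>open B\<close> pB] .
    have "x \<in> cuts" if "x \<noteq> 0"
      using xy that by (auto simp: cuts_def)
    then have "open (golden_rotation -` clopen_interval x y)"
      unfolding clopen_interval_eq[OF xy(1-4)] using clopen_vimage_golden_rotation xy(4)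
      by (auto simp: vimage_Diff intro!: open_Diff)
    then show ?thesis
      using xy(5,6) by (intro exI[of _ "golden_rotation -` clopen_interval x y"]) auto
  qed
  then show "open (golden_rotation -` B \<inter> UNIV)"
    by (subst open_subopen) auto
qed

section \<open>Orbits and invariant functions\<close>

lemma pos_funpow_golden_rotation:
  "\<exists>k :: int. pos ((golden_rotation ^^ n) p) = pos p + real n * golden - of_int k"
proof (induction n)
  case 0
  show ?case
    by (intro exI[of _ 0]) simp
next
  case (Suc n)
  then obtain k :: int where k: "pos ((golden_rotation ^^ n) p) = pos p + real n * golden - of_int k"
    by blast
  show ?case
    by (intro exI[of _ "k + 1 + indicator wrap ((golden_rotation ^^ n) p)"])
      (auto simp: pos_golden_rotation k algebra_simps indicator_def)
qed

lemma side_funpow_golden_rotation: "side ((golden_rotation ^^ n) p) = side p"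
  by (induction n) (simp_all add: side_golden_rotation)

text \<open>A return after \<open>n\<close> steps would be an integer relation between 1 and
  \<open>golden\<close>.\<close>

lemma golden_rotation_free:
  assumes "0 < n"
  shows "(golden_rotation ^^ n) p \<noteq> p"
proof
  assume *: "(golden_rotation ^^ n) p = p"
  obtain k :: int where "pos ((golden_rotation ^^ n) p) = pos p + real n * golden - of_int k"
    using pos_funpow_golden_rotation by blast
  then have "of_int (- k) + of_int (int n) * golden = 0"
    using * by simp
  then show False
    using golden_int_lincomb_eq_0[of "- k" "int n"] assms by simp
qed

interpretation golden: free_homeomorphism golden_rotation
  using continuous_golden_rotation bij_golden_rotation compact_split_interval golden_rotation_free
  by unfold_locales

lemma open_vimage_locally_constant:
  assumes "f \<in> golden.locally_constant"
  shows "open (f -` {c})"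
  using assms unfolding golden.locally_constant_def
proof (induction arbitrary: c)
  case (base f)
  then consider "f = 0" | U where "f = indicator U" "open U" "closed U"
    by auto
  then show ?case
  proof cases
    case 1
    then have "f -` {c} = (if c = 0 then UNIV else {})"
      by auto
    then show ?thesis
      by simp
  next
    case (2 U)
    then have "f -` {c} = (if c = 1 then U else if c = 0 then - U else {})"
      by (auto simp: indicator_def split: if_splits)
    then show ?thesis
      using 2 by (simp add: open_Compl)
  qed
next
  case (diff f g)
  have eq: "(f - g) -` {c} = (\<Union>d. f -` {c + d} \<inter> g -` {d})"
    by auto
  show ?case
    unfolding eq by (intro open_UN ballI open_Int diff.IH)
qed

text \<open>The positions along the orbit of the least point \<open>b\<close> are the fractional
  parts of the multiples of \<open>golden\<close>, which are dense. So the orbit enters every level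
  set that occurs, these being open.\<close>

lemma invariant_imp_constant:
  assumes "f \<in> golden.locally_constant" "f \<circ> golden_rotation = f"
  shows "\<exists>c. f = (\<lambda>_. c)"
proof -
  obtain b where b: "pos b = 0" "side b = 1"
    by (rule ex_point[of 0 1]) auto
  have inv: "f ((golden_rotation ^^ n) p) = f p" for n p
    using fun_cong[OF assms(2)] by (induction n) auto
  have "f q = f b" for q
  proof -
    have "open (f -` {f q})" "q \<in> f -` {f q}"
      using open_vimage_locally_constant[OF assms(1)] by auto
    then obtain x y where xy: "x \<in> golden_ints" "0 \<le> x" "x < y" "y \<in> cuts" "clopen_interval x y \<subseteq> f -` {f q}"
      using split_interval_basis by metis
    have y1: "y \<in> golden_ints" "y \<le> 1"
      using xy(4) by (auto simp: cuts_def)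
    obtain n where n: "\<bar>frac (real n * golden) - (x + y) / 2\<bar> < (y - x) / 2"
      by (rule Kronecker_approx_1_explicit[OF golden_irrational, of "(x + y) / 2" "(y - x) / 2"])
        (use xy y1 in auto)
    let ?p = "(golden_rotation ^^ n) b"
    obtain k :: int where k: "pos ?p = pos b + real n * golden - of_int k"
      using pos_funpow_golden_rotation by blast
    \<comment> \<open>The preserved side keeps the orbit away from the end point 1, so its positions
      are genuine fractional parts.\<close>
    have "side ?p = 1"
      by (simp add: side_funpow_golden_rotation b)
    then have "pos ?p \<noteq> 1"
      using side_eq(2)[of ?p] by auto
    then have "0 \<le> pos ?p" "pos ?p < 1"
      using pos_bounds[of ?p] by auto
    then have "frac (real n * golden) = pos ?p"
      using k b(1) by (simp add: frac_unique_iff)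
    then have "x < pos ?p" "pos ?p < y"
      using n by (auto simp: abs_if field_simps split: if_splits)
    then have "?p \<in> clopen_interval x y"
      using xy y1 by (subst clopen_interval_iff[OF Rep_eq]) auto
    then show ?thesis
      using xy(5) inv[of n b] by auto
  qed
  then show ?thesis
    by (intro exI[of _ "f b"]) auto
qed

section \<open>Initial segments generate the locally constant functions\<close>

abbreviation segment_span :: "(split_interval \<Rightarrow> int) set" where
  "segment_span \<equiv> group_closure (indicator ` initial_segment ` cuts)"

text \<open>Initial segments are nested, so the intersection of two of them is one of the two. The
  span is therefore closed under products.\<close>

lemma segment_span_mult:
  assumes "f \<in> segment_span" "g \<in> segment_span"
  shows "f * g \<in> segment_span"
proof -
  have minus: "a - b \<in> segment_span" if "a \<in> segment_span" "b \<in> segment_span" for a b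
    using that by (rule group_closure.diff)
  have gen: "indicator (initial_segment y) * indicator (initial_segment y') \<in> segment_span"
    if "y \<in> cuts" "y' \<in> cuts" for y y'
  proof -
    have "indicator (initial_segment y) * indicator (initial_segment y') =
        (indicator (initial_segment y \<inter> initial_segment y') :: _ \<Rightarrow> int)"
      by (rule ext) (simp add: indicator_inter_arith del: Int_atMost atMost_iff)
    moreover have "initial_segment y \<inter> initial_segment y' = initial_segment y \<or>
        initial_segment y \<inter> initial_segment y' = initial_segment y'"
      by (simp add: min_def)
    then have "initial_segment y \<inter> initial_segment y' \<in> initial_segment ` cuts"
      using imageI[OF that(1), of initial_segment] imageI[OF that(2), of initial_segment]
      by (elim disjE) (simp_all only:)
    ultimately show ?thesis
      by (simp only:) (intro group_closure_incl imageI)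
  qed
  have "indicator (initial_segment y) * g \<in> segment_span" if y: "y \<in> cuts" for y
    using assms(2)
  proof induction
    case (base g)
    then consider "g = 0" | y' where "g = indicator (initial_segment y')" "y' \<in> cuts"
      by auto
    then show ?case
    proof cases
      case 1
      have "indicator (initial_segment y) * (0 :: split_interval \<Rightarrow> int) = 0"
        by auto
      then show ?thesis
        unfolding 1 by (simp only: zero_in_group_closure)
    next
      case 2
      then show ?thesis
        using gen[OF y] by (simp only:)
    qed
  next
    case (diff g h)
    have "indicator (initial_segment y) * (g - h) =
        indicator (initial_segment y) * g - indicator (initial_segment y) * h"
      by (auto simp: fun_eq_iff right_diff_distrib)
    then show ?case
      using minus[OF diff.IH] by (simp only:)
  qed
  note gen' = this
  from assms(1) show ?thesis
  proof induction
    case (base f)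
    then consider "f = 0" | y where "f = indicator (initial_segment y)" "y \<in> cuts"
      by auto
    then show ?case
    proof cases
      case 1
      have "(0 :: split_interval \<Rightarrow> int) * g = 0"
        by auto
      then show ?thesis
        unfolding 1 by (simp only: zero_in_group_closure)
    next
      case 2
      then show ?thesis
        using gen' by (simp only:)
    qed
  next
    case (diff f h)
    have "(f - h) * g = f * g - h * g"
      by (auto simp: fun_eq_iff left_diff_distrib)
    then show ?case
      using minus[OF diff.IH] by (simp only:)
  qed
qed

lemma clopen_interval_segment_span:
  assumes "x \<in> golden_ints" "0 \<le> x" "x < y" "y \<in> cuts"
  shows "indicator (clopen_interval x y) \<in> segment_span" "open (clopen_interval x y)"
proof -
  have inc: "indicator (initial_segment z) \<in> segment_span" if "z \<in> cuts" for z
    using that by (intro group_closure_incl imageI)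
  have "indicator (clopen_interval x y) \<in> segment_span \<and> open (clopen_interval x y)"
  proof (cases "x = 0")
    case True
    then have "clopen_interval x y = initial_segment y"
      using clopen_interval_eq[OF assms] by simp
    then show ?thesis
      using inc[OF assms(4)] clopen_initial_segment[OF assms(4)] by (simp only: simp_thms)
  next
    case False
    then have x: "x \<in> cuts"
      using assms by (auto simp: cuts_def)
    have eq: "clopen_interval x y = initial_segment y - initial_segment x"
      using clopen_interval_eq[OF assms] False by simp
    have "initial_segment x \<subseteq> initial_segment y"
      using assms(3)
      by (intro subsetI) (auto simp: initial_segment_iff[OF x] initial_segment_iff[OF assms(4)] simp del: atMost_iff)
    then have "indicator (clopen_interval x y) =
        indicator (initial_segment y) - (indicator (initial_segment x) :: _ \<Rightarrow> int)"
      unfolding eq by (auto simp: indicator_def fun_eq_iff)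
    moreover have "\<dots> \<in> segment_span"
      by (intro group_closure.diff inc x assms(4))
    moreover have "open (clopen_interval x y)"
      unfolding eq using clopen_initial_segment[OF x] clopen_initial_segment[OF assms(4)]
      by (intro open_Diff)
    ultimately show ?thesis
      by (simp only: simp_thms)
  qed
  then show "indicator (clopen_interval x y) \<in> segment_span" "open (clopen_interval x y)"
    by auto
qed

text \<open>A clopen set is compact, hence a finite union of basic intervals. These may overlap:
  inclusion-exclusion expresses the union through products, which stay in the span.\<close>

lemma locally_constant_eq_segment_span: "golden.locally_constant = segment_span"
proof (rule equalityI)
  show "segment_span \<subseteq> golden.locally_constant"
    unfolding golden.locally_constant_def
  proof (rule group_closure_mono, rule subsetI)
    fix f :: "split_interval \<Rightarrow> int" assume "f \<in> indicator ` initial_segment ` cuts"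
    then obtain y where "f = indicator (initial_segment y)" "y \<in> cuts"
      by auto
    then show "f \<in> group_closure (indicator ` {U. open U \<and> closed U})"
      using clopen_initial_segment by (intro group_closure_incl) blast
  qed
  have "indicator U \<in> segment_span" if U: "open U" "closed U" for U
  proof -
    define \<C> where "\<C> = {clopen_interval x y | x y. x \<in> golden_ints \<and> 0 \<le> x \<and> x < y \<and> y \<in> cuts \<and> clopen_interval x y \<subseteq> U}"
    have "compact U"
      using golden.clopen_imp_compact U by blast
    moreover have "\<forall>V\<in>\<C>. open V"
      unfolding \<C>_def using clopen_interval_segment_span(2) by blast
    moreover have "U \<subseteq> \<Union>\<C>"
    proof
      fix p assume "p \<in> U"
      then obtain x y where "x \<in> golden_ints" "0 \<le> x" "x < y" "y \<in> cuts" "p \<in> clopen_interval x y"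
          "clopen_interval x y \<subseteq> U"
        using split_interval_basis[OF U(1)] by metis
      then show "p \<in> \<Union>\<C>"
        unfolding \<C>_def by blast
    qed
    ultimately obtain \<D> where \<D>: "\<D> \<subseteq> \<C>" "finite \<D>" "U \<subseteq> \<Union>\<D>"
      by (meson compactE)
    have "\<Union>\<D> = U"
      using \<D>(1,3) unfolding \<C>_def by blast
    moreover have "indicator (\<Union>\<D>) \<in> segment_span"
      using \<D>(2,1)
    proof induction
      case empty
      have "indicator (\<Union>{}) = (0 :: split_interval \<Rightarrow> int)"
        by auto
      then show ?case
        by (simp only: zero_in_group_closure)
    next
      case (insert V \<V>)
      then have "V \<in> \<C>"
        by simp
      then obtain x y where "V = clopen_interval x y" "x \<in> golden_ints" "0 \<le> x" "x < y" "y \<in> cuts"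
        unfolding \<C>_def by (elim CollectE exE conjE)
      then have V: "indicator V \<in> segment_span"
        by (simp only: clopen_interval_segment_span(1))
      have IH: "indicator (\<Union>\<V>) \<in> segment_span"
        using insert.IH insert.prems by simp
      have "indicator (\<Union>(insert V \<V>)) =
          indicator V + indicator (\<Union>\<V>) - (indicator V * indicator (\<Union>\<V>) :: split_interval \<Rightarrow> int)"
        by (auto simp: indicator_def fun_eq_iff)
      moreover have "\<dots> \<in> segment_span"
        by (intro group_closure.diff group_closure_add segment_span_mult V IH)
      ultimately show ?case
        by (simp only:)
    qed
    ultimately show ?thesis
      by simp
  qed
  then show "golden.locally_constant \<subseteq> segment_span"
    unfolding golden.locally_constant_def by (intro group_closure_mono) auto
qed

section \<open>Normal forms modulo coboundaries\<close>

definition coboundaries :: "(split_interval \<Rightarrow> int) set" where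
  "coboundaries = {(g \<circ> golden_rotation) - g | g. g \<in> golden.locally_constant}"

definition normal_form :: "int \<times> int \<Rightarrow> split_interval \<Rightarrow> int" where
  "normal_form ab p = fst ab + snd ab * indicator wrap p"

lemma coboundaries_diff: "f \<in> coboundaries \<Longrightarrow> g \<in> coboundaries \<Longrightarrow> f - g \<in> coboundaries"
  and coboundaries_add: "f \<in> coboundaries \<Longrightarrow> g \<in> coboundaries \<Longrightarrow> f + g \<in> coboundaries"
  and coboundaries_zero: "0 \<in> coboundaries"
  unfolding coboundaries_def golden.coboundaries_eq
  by (rule group_closure.diff group_closure_add zero_in_group_closure; assumption)+

lemma coboundaryI:
  "g \<in> golden.locally_constant \<Longrightarrow> (g \<circ> golden_rotation) - g \<in> coboundaries"
  unfolding coboundaries_def by blast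

lemma coboundaries_locally_constant: "coboundaries \<subseteq> golden.locally_constant"
  unfolding coboundaries_def golden.coboundaries_eq unfolding golden.locally_constant_def
proof (rule group_closure_mono, rule subsetI)
  fix f :: "split_interval \<Rightarrow> int"
  assume "f \<in> {indicator (golden.act n ` U) - indicator U | n U. open U \<and> closed U}"
  then obtain n U where f: "f = indicator (golden.act n ` U) - indicator U" and U: "open U \<and> closed U"
    by (elim CollectE exE conjE) simp
  have "f \<in> golden.locally_constant"
    unfolding f using U golden.clopen_act_image[OF U]
    by (intro golden.locally_constant_diff golden.indicator_in_locally_constant)
  then show "f \<in> group_closure (indicator ` {U. open U \<and> closed U})"
    by (simp only: golden.locally_constant_def)
qed

lemma normal_form_locally_constant: "normal_form ab \<in> golden.locally_constant"
proof -
  have w: "indicator wrap \<in> golden.locally_constant"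
    using clopen_wrap by (intro golden.indicator_in_locally_constant) simp
  have "(\<lambda>p. b * indicator wrap p) \<in> golden.locally_constant" for b :: int
  proof (induction b rule: int_induct[where k = 0])
    case base
    have "(\<lambda>p. 0 * indicator wrap p) = (0 :: split_interval \<Rightarrow> int)"
      by auto
    then show ?case
      by (simp only: golden.locally_constant_zero)
  next
    case (step1 i)
    have "(\<lambda>p. (i + 1) * indicator wrap p) = (\<lambda>p. i * indicator wrap p) + indicator wrap"
      by (auto simp: algebra_simps)
    then show ?case
      using golden.locally_constant_add[OF step1(2) w] by (simp only:)
  next
    case (step2 i)
    have "(\<lambda>p. (i - 1) * indicator wrap p) = (\<lambda>p. i * indicator wrap p) - indicator wrap"
      by (auto simp: algebra_simps)
    then show ?case
      using golden.locally_constant_diff[OF step2(2) w] by (simp only:)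
  qed
  from golden.locally_constant_add[OF golden.locally_constant_const this]
  have "(\<lambda>_. fst ab) + (\<lambda>p. snd ab * indicator wrap p) \<in> golden.locally_constant" .
  also have "(\<lambda>_. fst ab) + (\<lambda>p. snd ab * indicator wrap p) = normal_form ab"
    by (auto simp: normal_form_def)
  finally show ?thesis .
qed

lemma locally_constant_bounded:
  assumes "f \<in> golden.locally_constant"
  shows "\<exists>B. \<forall>p. \<bar>f p\<bar> \<le> B"
  using assms unfolding golden.locally_constant_def
proof induction
  case (base f)
  then have "\<bar>f p\<bar> \<le> 1" for p
    by (auto simp: indicator_def)
  then show ?case
    by blast
next
  case (diff f g)
  then obtain B B' where "\<And>p. \<bar>f p\<bar> \<le> B" "\<And>p. \<bar>g p\<bar> \<le> B'"
    by metis
  then have "\<bar>(f - g) p\<bar> \<le> B + B'" for p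
    by (metis abs_triangle_ineq4 add_mono minus_apply order_trans)
  then show ?case
    by blast
qed

text \<open>
  Since \<open>indicator wrap p = golden - 1 + pos p - pos (golden_rotation p)\<close>, a coboundary in normal form
  makes a constant real function into a coboundary of a bounded function.
\<close>

lemma normal_form_coboundary:
  assumes "normal_form ab \<in> coboundaries"
  shows "ab = (0, 0)"
proof -
  obtain a b where ab: "ab = (a, b)"
    by fastforce
  obtain g where g: "g \<in> golden.locally_constant" "normal_form ab = (g \<circ> golden_rotation) - g"
    using assms unfolding coboundaries_def by blast
  obtain B where B: "\<And>p. \<bar>g p\<bar> \<le> B"
    using locally_constant_bounded[OF g(1)] by blast
  define d where "d = of_int a + of_int b * (golden - 1)"
  let ?R = "\<lambda>n. golden_rotation ^^ n"
  fix p :: split_interval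
  have step: "g (golden_rotation q) = g q + a + b * indicator wrap q" for q
    using fun_cong[OF g(2), of q] by (simp add: normal_form_def ab)
  \<comment> \<open>Telescoping along the orbit: after \<open>n\<close> steps \<open>g\<close> has
    changed by \<open>n\<close> times the constant \<open>d\<close>, up to a term bounded by the
    absolute value of \<open>b\<close>. Boundedness of \<open>g\<close> then forces
    \<open>d = 0\<close>.\<close>
  have sum: "real_of_int (g (?R n p)) = of_int (g p) + real n * d + of_int b * (pos p - pos (?R n p))" for n
    by (induction n) (simp_all add: step pos_golden_rotation d_def algebra_simps indicator_def)
  have bound: "real n * \<bar>d\<bar> \<le> 2 * of_int B + \<bar>of_int b\<bar>" for n
  proof -
    have "\<bar>pos p - pos (?R n p)\<bar> \<le> 1"
      using pos_bounds[of p] pos_bounds[of "?R n p"] by auto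
    then have 1: "\<bar>of_int b * (pos p - pos (?R n p))\<bar> \<le> \<bar>of_int b\<bar>"
      by (simp add: abs_mult mult_left_le)
    have 2: "\<bar>real_of_int (g q)\<bar> \<le> of_int B" for q
      using B[of q] by linarith
    have "real n * \<bar>d\<bar> = \<bar>real n * d\<bar>"
      by (simp add: abs_mult)
    also have "\<dots> \<le> 2 * of_int B + \<bar>of_int b\<bar>"
      using sum[of n] 1 2[of p] 2[of "?R n p"] by linarith
    finally show ?thesis .
  qed
  have "d = 0"
  proof (rule ccontr)
    assume "d \<noteq> 0"
    then obtain n where "2 * of_int B + \<bar>of_int b\<bar> < real n * \<bar>d\<bar>"
      using reals_Archimedean3[of "\<bar>d\<bar>"] by auto
    then show False
      using bound[of n] by simp
  qed
  then have "of_int (a - b) + of_int b * golden = 0"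
    by (simp add: d_def algebra_simps)
  then show ?thesis
    using golden_int_lincomb_eq_0 ab by fastforce
qed

lemma normal_form_diff: "normal_form ab - normal_form cd = normal_form (ab - cd)"
  and normal_form_add: "normal_form ab + normal_form cd = normal_form (ab + cd)"
  by (auto simp: normal_form_def algebra_simps)

lemma normal_form_unique:
  assumes "f - normal_form ab \<in> coboundaries" "f - normal_form cd \<in> coboundaries"
  shows "ab = cd"
proof -
  have "(f - normal_form cd) - (f - normal_form ab) \<in> coboundaries"
    by (rule coboundaries_diff[OF assms(2,1)])
  also have "(f - normal_form cd) - (f - normal_form ab) = normal_form (ab - cd)"
    by (simp add: normal_form_diff[symmetric])
  finally have "ab - cd = (0, 0)"
    by (rule normal_form_coboundary)
  then show ?thesis
    by (simp add: prod_eq_iff)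
qed

lemma initial_segment_locally_constant:
  "y \<in> cuts \<Longrightarrow> indicator (initial_segment y) \<in> golden.locally_constant"
  using clopen_initial_segment by (intro golden.indicator_in_locally_constant) blast

text \<open>Induction on the coefficient of \<open>golden\<close> in \<open>y\<close>. A rotation
  step changes it by one, keeps the point in (0, 1], and alters the segment by a coboundary and a
  normal form. At coefficient 0 the only cut is 1, with the constant 1 as indicator.\<close>

lemma ex_normal_form_initial_segment:
  assumes "y \<in> cuts"
  shows "\<exists>ab. indicator (initial_segment y) - normal_form ab \<in> coboundaries"
proof -
  let ?N = "\<lambda>y. \<exists>ab. indicator (initial_segment y) - normal_form ab \<in> coboundaries"
  have rel: "?N y \<longleftrightarrow> ?N y'"
    if y: "y \<in> cuts" "y' \<in> cuts" "c = 0 \<or> c = 1" "y = y' + golden - 1 - of_int c" for y y' c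
  proof -
    let ?f = "indicator (initial_segment y) :: split_interval \<Rightarrow> int"
    let ?f' = "indicator (initial_segment y') :: split_interval \<Rightarrow> int"
    have eq: "?f \<circ> golden_rotation = ?f' + normal_form (- c, 1)"
      using initial_segment_golden_rotation[OF y] by (auto simp: normal_form_def)
    have cob: "(?f \<circ> golden_rotation) - ?f \<in> coboundaries"
      by (rule coboundaryI[OF initial_segment_locally_constant[OF y(1)]])
    show ?thesis
    proof
      assume "?N y"
      then obtain ab where "?f - normal_form ab \<in> coboundaries"
        by blast
      from coboundaries_add[OF cob this]
      have "?f' - normal_form (ab - (- c, 1)) \<in> coboundaries"
        by (simp add: eq normal_form_diff[symmetric] algebra_simps)
      then show "?N y'"
        by blast
    next
      assume "?N y'"
      then obtain ab where "?f' - normal_form ab \<in> coboundaries"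
        by blast
      from coboundaries_diff[OF this cob]
      have "?f - normal_form (ab + (- c, 1)) \<in> coboundaries"
        by (simp add: eq normal_form_add[symmetric] algebra_simps)
      then show "?N y"
        by blast
    qed
  qed
  have "?N y" if "y \<in> cuts" "y = of_int a + of_int b * golden" for a b y
    using that
  proof (induction b arbitrary: a y rule: int_induct[where k = 0])
    case base
    then have "0 < a" "a \<le> 1"
      by (simp_all add: cuts_def)
    then have "y = 1"
      using base(2) by simp
    then have "indicator (initial_segment y) - normal_form (1, 0) = 0"
      by (simp add: initial_segment_1 normal_form_def fun_eq_iff)
    then show ?case
      using coboundaries_zero by metis
  next
    case (step1 i)
    obtain c :: int and y' where c: "c = 0 \<or> c = 1" "y' \<in> cuts" "y = y' + golden - 1 - of_int c"
      using cuts_predecessor[OF step1.prems(1)] .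
    have "y' = of_int (a + 1 + c) + of_int i * golden"
      using c(3) step1.prems(2) by (simp add: algebra_simps)
    then have "?N y'"
      by (rule step1.IH[OF c(2)])
    then show ?case
      by (rule iffD2[OF rel[OF step1.prems(1) c(2,1,3)]])
  next
    \<comment> \<open>Below 0 the coefficient is raised by rotating forwards, so \<open>y\<close>
      now has the role of the predecessor and the equivalence is used in the opposite
      direction.\<close>
    case (step2 i)
    obtain c :: int and y' where c: "c = 0 \<or> c = 1" "y' \<in> cuts" "y' = y + golden - 1 - of_int c"
      using cuts_successor[OF step2.prems(1)] .
    have "y' = of_int (a - 1 - c) + of_int i * golden"
      using c(3) step2.prems(2) by (simp add: algebra_simps)
    then have "?N y'"
      by (rule step2.IH[OF c(2)])
    then show ?case
      by (rule iffD1[OF rel[OF c(2) step2.prems(1) c(1,3)]])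
  qed
  then show ?thesis
    using assms unfolding cuts_def golden_ints_def by blast
qed

lemma ex_normal_form:
  assumes "f \<in> golden.locally_constant"
  shows "\<exists>ab. f - normal_form ab \<in> coboundaries"
  using assms unfolding locally_constant_eq_segment_span
proof induction
  case (base f)
  have "normal_form (0, 0) = 0"
    by (auto simp: normal_form_def)
  then have "0 - normal_form (0, 0) \<in> coboundaries"
    by (simp add: coboundaries_zero)
  then show ?case
    using base ex_normal_form_initial_segment by blast
next
  case (diff f g)
  then obtain ab cd where "f - normal_form ab \<in> coboundaries" "g - normal_form cd \<in> coboundaries"
    by blast
  from coboundaries_diff[OF this] have "(f - g) - normal_form (ab - cd) \<in> coboundaries"
    by (simp add: normal_form_diff[symmetric] algebra_simps)
  then show ?case
    by blast
qed

theorem proposition8p21: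
  shows "groupoid_homology golden_groupoid 0 \<cong> integer_group \<times>\<times> integer_group \<and>
         groupoid_homology golden_groupoid 1 \<cong> integer_group"
proof
  \<comment> \<open>The isomorphism in degree 0 reads off the coefficients of the normal form; its
    kernel consists of the functions with normal form 0, that is, of the coboundaries.\<close>
  define h where "h f = (THE ab. f - normal_form ab \<in> coboundaries)" for f
  have h_eq: "h f = ab" if "f - normal_form ab \<in> coboundaries" for f ab
    unfolding h_def using that normal_form_unique by (intro the_equality) auto
  have h: "f - normal_form (h f) \<in> coboundaries" if "f \<in> golden.locally_constant" for f
    using ex_normal_form[OF that] h_eq by auto
  show "groupoid_homology golden_groupoid 0 \<cong> integer_group \<times>\<times> integer_group"
    unfolding golden_groupoid_def
  proof (rule golden.homology_0_iso)
    show "group (integer_group \<times>\<times> integer_group)"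
      by (simp add: DirProd_group)
    show "h (f + g) = h f \<otimes>\<^bsub>integer_group \<times>\<times> integer_group\<^esub> h g"
      if "f \<in> golden.locally_constant" "g \<in> golden.locally_constant" for f g
    proof -
      from coboundaries_add[OF h[OF that(1)] h[OF that(2)]]
      have "(f + g) - normal_form (h f + h g) \<in> coboundaries"
        by (simp add: normal_form_add[symmetric] algebra_simps)
      then have "h (f + g) = h f + h g"
        by (rule h_eq)
      then show ?thesis
        by (cases "h f"; cases "h g") simp
    qed
    have "h (normal_form ab) = ab" for ab
      by (rule h_eq) (simp add: coboundaries_zero)
    then have "range h \<subseteq> h ` golden.locally_constant" "surj h"
      using normal_form_locally_constant by (auto simp: image_iff) metis+
    then show "h ` golden.locally_constant = carrier (integer_group \<times>\<times> integer_group)"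
      by auto
    have nf0: "normal_form (0, 0) = 0"
      by (auto simp: normal_form_def)
    have "f \<in> golden.locally_constant \<and> h f = (0, 0) \<longleftrightarrow> f \<in> coboundaries" for f
    proof
      assume "f \<in> golden.locally_constant \<and> h f = (0, 0)"
      then show "f \<in> coboundaries"
        using h[of f] nf0 by simp
    next
      assume "f \<in> coboundaries"
      then show "f \<in> golden.locally_constant \<and> h f = (0, 0)"
        using coboundaries_locally_constant h_eq[of f "(0, 0)"] nf0 by auto
    qed
    then show "{f \<in> golden.locally_constant. h f = \<one>\<^bsub>integer_group \<times>\<times> integer_group\<^esub>} =
        {(g \<circ> golden_rotation) - g | g. g \<in> golden.locally_constant}"
      unfolding coboundaries_def[symmetric] by auto
  qed
  show "groupoid_homology golden_groupoid 1 \<cong> integer_group"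
    unfolding golden_groupoid_def by (rule golden.homology_1_iso) (rule invariant_imp_constant)
qed

end
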